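(* Let $q\in S(k+)$, assume $p\ge2$ (with $p$, $n_l$, $s_l$, $a_{l,j}$ as in the context), let $j\in\{1,\dots,s_2\}$, put $\delta=a_{2,j}$, and let $\varphi_{2,j}$ be a root function of $L_t(q)$ corresponding to $\lambda$ of the form $$\varphi_{2,j}(x)=e^{i\langle\delta+n_2v_k+t,x\rangle}+\sum_{n=n_2+1}^{\infty}\left(\sum_{a\in\Gamma(k)}(\varphi_{2,j},e^{i\langle a+nv_k+t,x\rangle})\,e^{i\langle a+nv_k+t,x\rangle}\right).$$ Define numbers $c(a,n)$ for $a\in\Gamma(k)$ and $n=n_2+1,\dots,n_1-1$ recursively in $n$ by $$(\lambda-|a+nv_k+t|^2)\,c(a,n)=q_{a-\delta+(n-n_2)v_k}+\sum_{m=1}^{n-n_2-1}\ \sum_{u\in\Gamma(k)}c(a-u,n-m)\,q_{u+mv_k}.$$ Then $\varphi_{2,j}$ is an eigenfunction of $L_t(q)$ if and only if $$q_{a_{1,i}-\delta+(n_1-n_2)v_k}+\sum_{m=1}^{n_1-n_2-1}\ \sum_{u\in\Gamma(k)}c(a_{1,i}-u,n_1-m)\,q_{u+mv_k}=0\qquad\text{for all } i=1,2,\dots,s_1.$$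
   Context: $d\ge2$; $\Omega$ is a lattice in $\mathbb R^d$, $F=\mathbb R^d/\Omega$ is its fundamental domain, of measure $1$; $\Gamma=\{\gamma\in\mathbb R^d:\langle\gamma,\omega\rangle\in2\pi\mathbb Z\ \forall\omega\in\Omega\}$ is the dual lattice with a fixed basis $v_1,\dots,v_d$; $t\in F^{\ast}=\mathbb R^d/\Gamma$, regarded as a vector of $\mathbb R^d$. $(\cdot,\cdot)$ is the inner product of $L_2(F)$, $\mathbb N=\{1,2,\dots\}$. Fix $k\in\{1,\dots,d\}$. $\Gamma(k)$ is the sublattice generated by $\{v_1,\dots,v_d\}\setminus\{v_k\}$, $\Gamma(k+)=\{u+nv_k:u\in\Gamma(k),n\in\mathbb N\}$, and $\Gamma(k,p)=\{pv_k+a:a\in\Gamma(k)\}$ for $p\in\mathbb Z$. $S(k+)$ is the set of potentials $q(x)=\sum_{\gamma\in\Gamma(k+)}q_\gamma e^{i\langle\gamma,x\rangle}$ with complex coefficients $q_\gamma=(q,e^{i\langle\gamma,x\rangle})$ satisfying $\sum_{\gamma\in\Gamma(k+)}|q_\gamma|<\infty$. $L_t(q)$ is the operator generated in $L_2(F)$ by $-\Delta\Psi+q\Psi$ and the conditions $\Psi(x+\omega)=e^{i\langle t,\omega\rangle}\Psi(x)$ for all $\omega\in\Omega$. Let $\lambda$ be a multiple eigenvalue of $L_t(0)$ of multiplicity $m$, and let $b_1,\dots,b_m$ be the distinct vectors of $\Gamma$ with $|b_i+t|^2=\lambda$. Each $b_i$ lies in $\Gamma(k,p_i)$ for a unique integer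 $p_i$; let $n_1>n_2>\dots>n_p$ be the distinct values among the $p_i$. For $l=1,\dots,p$ denote by $b_{l,j}=a_{l,j}+n_lv_k$, $a_{l,j}\in\Gamma(k)$, $j=1,\dots,s_l$, those of the vectors $b_1,\dots,b_m$ that lie in $\Gamma(k,n_l)$. (Hence $\lambda\neq|a+nv_k+t|^2$ for all $a\in\Gamma(k)$ and $n_2<n<n_1$, so the numbers $c(a,n)$ in the claim are well defined.) Empty sums are zero. A root function corresponding to $\lambda$ is an eigenfunction or associated function, i.e. a nonzero $\varphi$ with $(L_t(q)-\lambda I)^r\varphi=0$ for some $r\in\mathbb N$. *)

theory Defs
  imports "HOL-Analysis.Analysis"
begin

definition int_span :: "'i set \<Rightarrow> ('i \<Rightarrow> 'v::real_vector) \<Rightarrow> 'v set"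
  where "int_span I v = range (\<lambda>c::'i \<Rightarrow> int. \<Sum>i\<in>I. real_of_int (c i) *\<^sub>R v i)"

definition lattice_basis :: "('n::finite \<Rightarrow> real^'n) \<Rightarrow> (real^'n) set \<Rightarrow> bool"
  where "lattice_basis v L \<longleftrightarrow> inj v \<and> independent (range v) \<and> L = int_span UNIV v"

definition fundamental_domain :: "('n::finite \<Rightarrow> real^'n) \<Rightarrow> (real^'n) set"
  where "fundamental_domain w = {\<Sum>i\<in>UNIV. s i *\<^sub>R w i | s. \<forall>i. 0 \<le> s i \<and> s i < 1}"

definition dual_lattice :: "(real^'n::finite) set \<Rightarrow> (real^'n) set"
  where "dual_lattice \<Omega> = {\<gamma>. \<forall>\<omega>\<in>\<Omega>. \<exists>z::int. \<gamma> \<bullet> \<omega> = 2 * pi * real_of_int z}"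

definition sublattice :: "('n::finite \<Rightarrow> real^'n) \<Rightarrow> 'n \<Rightarrow> (real^'n) set"
  where "sublattice v k = int_span (UNIV - {k}) v"

definition sublattice_plus :: "('n::finite \<Rightarrow> real^'n) \<Rightarrow> 'n \<Rightarrow> (real^'n) set"
  where "sublattice_plus v k = {u + real n *\<^sub>R v k | u n. u \<in> sublattice v k \<and> n \<ge> 1}"

definition sublattice_layer :: "('n::finite \<Rightarrow> real^'n) \<Rightarrow> 'n \<Rightarrow> int \<Rightarrow> (real^'n) set"
  where "sublattice_layer v k p = {real_of_int p *\<^sub>R v k + a | a. a \<in> sublattice v k}"

definition expi :: "real^'n::finite \<Rightarrow> real^'n \<Rightarrow> complex"
  where "expi \<gamma> x = cis (\<gamma> \<bullet> x)"


text \<open>Elements of $L_2(F)$ are represented by functions on the whole space, of which only the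
  values on \<open>F\<close>, up to null sets, matter.\<close>

definition l2_space :: "(real^'n::finite) set \<Rightarrow> (real^'n \<Rightarrow> complex) set"
  where "l2_space F = {f \<in> borel_measurable (lebesgue_on F).
                          integrable (lebesgue_on F) (\<lambda>x. (cmod (f x))\<^sup>2)}"

definition l2_inner :: "(real^'n::finite) set \<Rightarrow> (real^'n \<Rightarrow> complex) \<Rightarrow> (real^'n \<Rightarrow> complex) \<Rightarrow> complex"
  where "l2_inner F f g = (LINT x|lebesgue_on F. f x * cnj (g x))"

definition l2_norm :: "(real^'n::finite) set \<Rightarrow> (real^'n \<Rightarrow> complex) \<Rightarrow> real"
  where "l2_norm F f = sqrt (LINT x|lebesgue_on F. (cmod (f x))\<^sup>2)"

text \<open>The membership conditions matter: the integral in \<^const>\<open>l2_norm\<close> is \<open>0\<close> by convention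
  for functions that are not square integrable.\<close>

definition l2_tendsto :: "(real^'n::finite) set \<Rightarrow> ('i \<Rightarrow> real^'n \<Rightarrow> complex) \<Rightarrow>
    (real^'n \<Rightarrow> complex) \<Rightarrow> 'i filter \<Rightarrow> bool"
  where "l2_tendsto F f l G \<longleftrightarrow>
    l \<in> l2_space F \<and> (\<forall>\<^sub>F i in G. f i \<in> l2_space F) \<and>
    ((\<lambda>i. l2_norm F (\<lambda>x. f i x - l x)) \<longlongrightarrow> 0) G"

definition l2_has_sum :: "(real^'n::finite) set \<Rightarrow> ('i \<Rightarrow> real^'n \<Rightarrow> complex) \<Rightarrow>
    (real^'n \<Rightarrow> complex) \<Rightarrow> 'i set \<Rightarrow> bool"
  where "l2_has_sum F f s A \<longleftrightarrow>
    l2_tendsto F (\<lambda>X x. \<Sum>i\<in>X. f i x) s (finite_subsets_at_top A)"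

definition fourier_coeff :: "(real^'n::finite) set \<Rightarrow> (real^'n \<Rightarrow> complex) \<Rightarrow> real^'n \<Rightarrow> complex"
  where "fourier_coeff F q \<gamma> = l2_inner F q (expi \<gamma>)"

definition potentials_plus :: "(real^'n::finite) set \<Rightarrow> ('n \<Rightarrow> real^'n) \<Rightarrow> 'n \<Rightarrow>
    (real^'n \<Rightarrow> complex) set"
  where "potentials_plus F v k = {q.
    (\<lambda>\<gamma>. cmod (fourier_coeff F q \<gamma>)) summable_on sublattice_plus v k \<and>
    (\<forall>x. ((\<lambda>\<gamma>. fourier_coeff F q \<gamma> * expi \<gamma> x) has_sum q x) (sublattice_plus v k))}"


definition partial_deriv :: "'n::finite \<Rightarrow> (real^'n \<Rightarrow> complex) \<Rightarrow> real^'n \<Rightarrow> complex"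
  where "partial_deriv i f x = vector_derivative (\<lambda>s. f (x + s *\<^sub>R axis i 1)) (at 0)"

definition C1 :: "(real^'n::finite \<Rightarrow> complex) \<Rightarrow> bool"
  where "C1 f \<longleftrightarrow> continuous_on UNIV f \<and>
    (\<forall>i. (\<forall>x. (\<lambda>s. f (x + s *\<^sub>R axis i 1)) differentiable (at 0)) \<and>
         continuous_on UNIV (partial_deriv i f))"

definition C2 :: "(real^'n::finite \<Rightarrow> complex) \<Rightarrow> bool"
  where "C2 f \<longleftrightarrow> C1 f \<and> (\<forall>i. C1 (partial_deriv i f))"

definition laplacian :: "(real^'n::finite \<Rightarrow> complex) \<Rightarrow> real^'n \<Rightarrow> complex"
  where "laplacian f x = (\<Sum>i\<in>UNIV. partial_deriv i (partial_deriv i f) x)"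

definition quasi_periodic :: "(real^'n::finite) set \<Rightarrow> real^'n \<Rightarrow> (real^'n \<Rightarrow> complex) \<Rightarrow> bool"
  where "quasi_periodic \<Omega> t \<Psi> \<longleftrightarrow> (\<forall>x. \<forall>\<omega>\<in>\<Omega>. \<Psi> (x + \<omega>) = cis (t \<bullet> \<omega>) * \<Psi> x)"

text \<open>The operator generated in $L_2(F)$ by $-\Delta\Psi + q\Psi$ and the quasi-periodicity
  conditions, given by its graph: the closure in $L_2(F) \times L_2(F)$ of the differential
  expression on the twice continuously differentiable functions satisfying the conditions.  For
  bounded \<open>q\<close> its domain consists of the quasi-periodic functions in the Sobolev space $W_2^2$.
  The graph is invariant under changes on null sets in both components.\<close>

definition schroedinger_op :: "(real^'n::finite) set \<Rightarrow> (real^'n) set \<Rightarrow> real^'n \<Rightarrow>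
    (real^'n \<Rightarrow> complex) \<Rightarrow> ((real^'n \<Rightarrow> complex) \<times> (real^'n \<Rightarrow> complex)) set"
  where "schroedinger_op F \<Omega> t q = {(\<psi>, g). \<exists>\<Psi>::nat \<Rightarrow> real^'n \<Rightarrow> complex.
    (\<forall>j. C2 (\<Psi> j) \<and> quasi_periodic \<Omega> t (\<Psi> j)) \<and>
    l2_tendsto F \<Psi> \<psi> sequentially \<and>
    l2_tendsto F (\<lambda>j x. - laplacian (\<Psi> j) x + q x * \<Psi> j x) g sequentially}"

definition shifted_op :: "((real^'n::finite \<Rightarrow> complex) \<times> (real^'n \<Rightarrow> complex)) set \<Rightarrow> complex \<Rightarrow>
    ((real^'n \<Rightarrow> complex) \<times> (real^'n \<Rightarrow> complex)) set"
  where "shifted_op T \<mu> = {(f, \<lambda>x. g x - \<mu> * f x) | f g. (f, g) \<in> T}"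

definition eigenfunction :: "(real^'n::finite) set \<Rightarrow>
    ((real^'n \<Rightarrow> complex) \<times> (real^'n \<Rightarrow> complex)) set \<Rightarrow> complex \<Rightarrow> (real^'n \<Rightarrow> complex) \<Rightarrow> bool"
  where "eigenfunction F T \<mu> \<phi> \<longleftrightarrow>
    \<not> (AE x in lebesgue_on F. \<phi> x = 0) \<and> (\<phi>, \<lambda>x. \<mu> * \<phi> x) \<in> T"

definition root_function :: "(real^'n::finite) set \<Rightarrow>
    ((real^'n \<Rightarrow> complex) \<times> (real^'n \<Rightarrow> complex)) set \<Rightarrow> complex \<Rightarrow> (real^'n \<Rightarrow> complex) \<Rightarrow> bool"
  where "root_function F T \<mu> \<phi> \<longleftrightarrow>
    \<not> (AE x in lebesgue_on F. \<phi> x = 0) \<and>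
    (\<exists>r\<ge>1. (\<phi>, \<lambda>x. 0) \<in> shifted_op T \<mu> ^^ r)"

text \<open>\<open>\<mu>\<close> is an eigenvalue of multiplicity \<open>m\<close>: the root functions, together with zero, form a
  space of dimension \<open>m \<ge> 1\<close> modulo null functions.\<close>

definition eigenvalue_of_multiplicity :: "(real^'n::finite) set \<Rightarrow>
    ((real^'n \<Rightarrow> complex) \<times> (real^'n \<Rightarrow> complex)) set \<Rightarrow> complex \<Rightarrow> nat \<Rightarrow> bool"
  where "eigenvalue_of_multiplicity F T \<mu> m \<longleftrightarrow> m \<ge> 1 \<and>
    (\<exists>f::nat \<Rightarrow> real^'n \<Rightarrow> complex.
      (\<forall>i\<in>{1..m}. root_function F T \<mu> (f i)) \<and>
      (\<forall>\<alpha>. (AE x in lebesgue_on F. (\<Sum>i=1..m. \<alpha> i * f i x) = 0) \<longrightarrow> (\<forall>i\<in>{1..m}. \<alpha> i = 0)) \<and>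
      (\<forall>\<phi>. root_function F T \<mu> \<phi> \<longrightarrow>
        (\<exists>\<alpha>. AE x in lebesgue_on F. \<phi> x = (\<Sum>i=1..m. \<alpha> i * f i x))))"

end

theory Submission
  imports Defs
begin

text \<open>Put \<open>e\<^sub>\<gamma>(x) = exp (i (\<gamma> + t) \<bullet> x)\<close> for \<open>\<gamma>\<close> in the dual lattice \<open>\<Gamma>\<close>, and let the height of \<open>\<gamma>\<close> be its
  \<open>v k\<close>-coordinate. On the coefficients \<open>hat \<psi> \<gamma> = (\<psi>, e\<^sub>\<gamma>)\<close> the operator acts by

  \<open>hat (L \<psi>) \<gamma> = |\<gamma> + t|\<^sup>2 hat \<psi> \<gamma> + conv \<psi> \<gamma>\<close>,  where
  \<open>conv \<psi> \<gamma> = (\<Sum>\<beta>. q\<^sub>\<beta> hat \<psi> (\<gamma> - \<beta>))\<close> (lemmas \<open>operator_hat\<close>, \<open>conv_has_sum\<close>).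

  All frequencies \<open>\<beta>\<close> of \<open>q\<close> have height at least 1, so \<open>conv \<psi> \<gamma>\<close> only sees coefficients of \<open>\<psi>\<close>
  on layers strictly below \<open>\<gamma>\<close>: the operator is triangular with respect to height, with diagonal
  \<open>|\<gamma> + t|\<^sup>2\<close>. Everything follows from this triangularity.

  The hypothesis on the form of \<open>\<phi>\<close> says that its coefficients vanish on the layers up to \<open>n 2\<close>
  except for the value 1 at \<open>\<delta> + n 2 v k\<close> (\<open>hat_low_layers\<close>). If \<open>L \<phi> = \<mu> \<phi>\<close>, comparing
  coefficients at that vector gives \<open>\<mu> = \<lambda>\<close>. On the layers strictly between \<open>n 2\<close> and \<open>n 1\<close> there
  is no resonance \<open>|\<gamma> + t|\<^sup>2 = \<lambda>\<close>, hence the coefficients of \<open>\<phi>\<close> solve the recursion that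
  defines \<open>c\<close> and coincide with \<open>c\<close>. At a resonant vector of layer \<open>n 1\<close> the diagonal term vanishes,
  so the equation reads \<open>conv \<phi> \<gamma> = 0\<close>, and \<open>conv \<phi> \<gamma>\<close> is exactly the expression in the claim
  (\<open>conv_eq_recursion\<close>).

  Conversely let \<open>\<phi>\<close> be a root function and \<open>g = (L - \<lambda>) \<phi>\<close>. Some power of \<open>L - \<lambda>\<close> annihilates
  \<open>g\<close>; by triangularity the lowest layer on which \<open>hat g\<close> is not zero can carry only resonant
  vectors (\<open>lowest_layer_resonant\<close>). It lies above \<open>n 2\<close>, so it could only be \<open>n 1\<close>. But below
  \<open>n 1\<close> the vanishing of \<open>hat g\<close> forces the coefficients of \<open>\<phi>\<close> to equal \<open>c\<close>, and then the
  condition in the claim says that \<open>hat g\<close> vanishes at the resonant vectors of layer \<open>n 1\<close> too.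
  So there is no lowest layer, and all coefficients of \<open>g\<close> are zero.

  Two facts of analysis carry this over to functions. The action of the Laplacian on coefficients is
  integration by parts over the cell \<open>F\<close>; it comes from the translation invariance of the
  integral of a periodic function over \<open>F\<close> (\<open>integral_shift\<close>, \<open>inner_laplacian\<close>). That a function
  without nonzero coefficients is zero almost everywhere comes from the Stone--Weierstrass theorem
  on the torus (\<open>periodic_approximation\<close>, \<open>zero_if_coefficients_zero\<close>); it is
  stated for limits of continuous quasi-periodic functions, which is what the operator produces.\<close>

section \<open>Square integrable functions\<close>

lemma l2_spaceD:
  assumes "f \<in> l2_space F"
  shows "f \<in> borel_measurable (lebesgue_on F)" "integrable (lebesgue_on F) (\<lambda>x. (cmod (f x))\<^sup>2)"
  using assms by (auto simp: l2_space_def)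

lemma l2_prod_integrable:
  assumes f: "f \<in> l2_space F" and g: "g \<in> l2_space F"
  shows "integrable (lebesgue_on F) (\<lambda>x. f x * cnj (g x))"
proof (rule Bochner_Integration.integrable_bound)
  show "integrable (lebesgue_on F) (\<lambda>x. (cmod (f x))\<^sup>2 + (cmod (g x))\<^sup>2)"
    using l2_spaceD[OF f] l2_spaceD[OF g] by auto
  have [measurable]: "f \<in> borel_measurable (lebesgue_on F)" "g \<in> borel_measurable (lebesgue_on F)"
    using l2_spaceD f g by auto
  show "(\<lambda>x. f x * cnj (g x)) \<in> borel_measurable (lebesgue_on F)"
    by (intro borel_measurable_times measurable_compose[OF _ borel_measurable_continuous_onI[of cnj]])
       (auto intro: continuous_intros)
  have "a * b \<le> a\<^sup>2 + b\<^sup>2" if "a \<ge> 0" "b \<ge> 0" for a b :: real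
    using sum_squares_bound[of a b] that mult_nonneg_nonneg[OF that] by linarith
  then show "AE x in lebesgue_on F. norm (f x * cnj (g x)) \<le> norm ((cmod (f x))\<^sup>2 + (cmod (g x))\<^sup>2)"
    by (intro AE_I2) (simp add: norm_mult)
qed

lemma l2_space_scale:
  assumes "f \<in> l2_space F"
  shows "(\<lambda>x. c * f x) \<in> l2_space F"
  using assms by (auto simp: l2_space_def norm_mult power_mult_distrib)

lemma l2_space_add:
  assumes f: "f \<in> l2_space F" and g: "g \<in> l2_space F"
  shows "(\<lambda>x. f x + g x) \<in> l2_space F"
proof -
  have [measurable]: "f \<in> borel_measurable (lebesgue_on F)" "g \<in> borel_measurable (lebesgue_on F)"
    using l2_spaceD f g by auto
  have "integrable (lebesgue_on F) (\<lambda>x. (cmod (f x + g x))\<^sup>2)"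
  proof (rule Bochner_Integration.integrable_bound)
    show "integrable (lebesgue_on F) (\<lambda>x. 2 * (cmod (f x))\<^sup>2 + 2 * (cmod (g x))\<^sup>2)"
      using l2_spaceD[OF f] l2_spaceD[OF g] by auto
    have "(cmod (f x + g x))\<^sup>2 \<le> 2 * (cmod (f x))\<^sup>2 + 2 * (cmod (g x))\<^sup>2" for x
    proof -
      have "(cmod (f x + g x))\<^sup>2 \<le> (cmod (f x) + cmod (g x))\<^sup>2"
        by (intro power_mono norm_triangle_ineq) auto
      also have "\<dots> \<le> 2 * (cmod (f x))\<^sup>2 + 2 * (cmod (g x))\<^sup>2"
        using sum_squares_bound[of "cmod (f x)" "cmod (g x)"] by (simp add: power2_sum)
      finally show ?thesis .
    qed
    then show "AE x in lebesgue_on F. norm ((cmod (f x + g x))\<^sup>2) \<le> norm (2 * (cmod (f x))\<^sup>2 + 2 * (cmod (g x))\<^sup>2)"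
      by (intro AE_I2) simp
  qed simp
  then show ?thesis by (simp add: l2_space_def)
qed

lemma l2_space_diff:
  assumes "f \<in> l2_space F" "g \<in> l2_space F"
  shows "(\<lambda>x. f x - g x) \<in> l2_space F"
  using l2_space_add[OF assms(1) l2_space_scale[OF assms(2), of "-1"]] by simp

lemma l2_space_mult_bounded:
  assumes f: "f \<in> l2_space F" and h: "h \<in> borel_measurable (lebesgue_on F)"
    and bound: "\<And>x. cmod (h x) \<le> B"
  shows "(\<lambda>x. h x * f x) \<in> l2_space F"
proof -
  have [measurable]: "f \<in> borel_measurable (lebesgue_on F)" using l2_spaceD f by auto
  note h[measurable]
  have "integrable (lebesgue_on F) (\<lambda>x. (cmod (h x * f x))\<^sup>2)"
  proof (rule Bochner_Integration.integrable_bound)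
    show "integrable (lebesgue_on F) (\<lambda>x. B\<^sup>2 * (cmod (f x))\<^sup>2)"
      using l2_spaceD[OF f] by auto
    show "AE x in lebesgue_on F. norm ((cmod (h x * f x))\<^sup>2) \<le> norm (B\<^sup>2 * (cmod (f x))\<^sup>2)"
      by (intro AE_I2) (simp add: norm_mult power_mult_distrib mult_right_mono power_mono bound)
  qed simp
  then show ?thesis by (simp add: l2_space_def)
qed

lemma l2_inner_add:
  assumes "f \<in> l2_space F" "g \<in> l2_space F" "h \<in> l2_space F"
  shows "l2_inner F (\<lambda>x. f x + g x) h = l2_inner F f h + l2_inner F g h"
  unfolding l2_inner_def
  using l2_prod_integrable[OF assms(1,3)] l2_prod_integrable[OF assms(2,3)]
  by (simp add: distrib_right)

lemma l2_inner_diff: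
  assumes "f \<in> l2_space F" "g \<in> l2_space F" "h \<in> l2_space F"
  shows "l2_inner F (\<lambda>x. f x - g x) h = l2_inner F f h - l2_inner F g h"
  unfolding l2_inner_def
  using l2_prod_integrable[OF assms(1,3)] l2_prod_integrable[OF assms(2,3)]
  by (simp add: left_diff_distrib)

lemma l2_inner_scale: "l2_inner F (\<lambda>x. c * f x) g = c * l2_inner F f g"
  unfolding l2_inner_def by (simp add: mult.assoc)

lemma l2_space_zero: "(\<lambda>x. 0) \<in> l2_space F"
  by (simp add: l2_space_def)

lemma l2_sum:
  assumes "\<And>i. i \<in> X \<Longrightarrow> f i \<in> l2_space F" and g: "g \<in> l2_space F"
  shows "(\<lambda>x. \<Sum>i\<in>X. f i x) \<in> l2_space F"
    and "l2_inner F (\<lambda>x. \<Sum>i\<in>X. f i x) g = (\<Sum>i\<in>X. l2_inner F (f i) g)"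
proof -
  have "(\<lambda>x. \<Sum>i\<in>X. f i x) \<in> l2_space F \<and>
      l2_inner F (\<lambda>x. \<Sum>i\<in>X. f i x) g = (\<Sum>i\<in>X. l2_inner F (f i) g)"
    using assms(1)
  proof (induction X rule: infinite_finite_induct)
    case (insert a X)
    then show ?case using l2_inner_add[of "f a" F "\<lambda>x. \<Sum>i\<in>X. f i x" g] g
      by (auto intro: l2_space_add)
  qed (auto simp: l2_space_zero l2_inner_def)
  then show "(\<lambda>x. \<Sum>i\<in>X. f i x) \<in> l2_space F"
    "l2_inner F (\<lambda>x. \<Sum>i\<in>X. f i x) g = (\<Sum>i\<in>X. l2_inner F (f i) g)" by auto
qed

lemma l2_norm_nonneg: "l2_norm F f \<ge> 0"
  by (simp add: l2_norm_def)

lemma l2_norm_power2: "(l2_norm F f)\<^sup>2 = (LINT x|lebesgue_on F. (cmod (f x))\<^sup>2)"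
  by (simp add: l2_norm_def)

text \<open>Integrating \<open>2 |f| |g| \<le> s |f|\<^sup>2 + |g|\<^sup>2 / s\<close> bounds twice the inner product for every \<open>s > 0\<close>;
  the best \<open>s\<close> is \<open>\<parallel>g\<parallel> / \<parallel>f\<parallel>\<close>. When one norm is zero there is no best \<open>s\<close>, and a value of \<open>s\<close>
  depending on the inner product gives a contradiction.\<close>

lemma l2_cauchy_schwarz:
  assumes f: "f \<in> l2_space F" and g: "g \<in> l2_space F"
  shows "cmod (l2_inner F f g) \<le> l2_norm F f * l2_norm F g"
proof -
  define A where "A = l2_norm F f"
  define B where "B = l2_norm F g"
  define I where "I = cmod (l2_inner F f g)"
  have AB: "A \<ge> 0" "B \<ge> 0" "I \<ge> 0" by (auto simp: A_def B_def I_def l2_norm_nonneg)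
  have *: "2 * I \<le> s * A\<^sup>2 + B\<^sup>2 / s" if s: "s > 0" for s
  proof -
    have "I \<le> (LINT x|lebesgue_on F. cmod (f x * cnj (g x)))"
      unfolding I_def l2_inner_def by simp
    also have "\<dots> \<le> (LINT x|lebesgue_on F. (s/2) * (cmod (f x))\<^sup>2 + (1/(2 * s)) * (cmod (g x))\<^sup>2)"
    proof (rule integral_mono)
      show "integrable (lebesgue_on F) (\<lambda>x. cmod (f x * cnj (g x)))"
        using l2_prod_integrable[OF f g] by (rule integrable_norm)
      show "integrable (lebesgue_on F) (\<lambda>x. (s/2) * (cmod (f x))\<^sup>2 + (1/(2 * s)) * (cmod (g x))\<^sup>2)"
        using l2_spaceD[OF f] l2_spaceD[OF g] by auto
      fix x
      have "0 \<le> (s * cmod (f x) - cmod (g x))\<^sup>2" by simp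
      then show "cmod (f x * cnj (g x)) \<le> (s/2) * (cmod (f x))\<^sup>2 + (1/(2 * s)) * (cmod (g x))\<^sup>2"
        using s by (simp add: norm_mult field_simps power2_eq_square)
    qed
    also have "\<dots> = (s/2) * A\<^sup>2 + (1/(2 * s)) * B\<^sup>2"
      using l2_spaceD[OF f] l2_spaceD[OF g] by (simp add: A_def B_def l2_norm_power2)
    finally show ?thesis using s by (simp add: field_simps)
  qed
  have "I \<le> A * B"
  proof (cases "A > 0")
    case True
    show ?thesis
    proof (cases "B > 0")
      case B: True
      show ?thesis using *[of "B / A"] True B by (simp add: field_simps power2_eq_square)
    next
      case False
      then have "B = 0" using AB by simp
      have "I \<le> 0"
      proof (rule ccontr)
        assume "\<not> I \<le> 0"
        then show False using *[of "I / A\<^sup>2"] True \<open>B = 0\<close> by simp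
      qed
      then show ?thesis using \<open>B = 0\<close> by simp
    qed
  next
    case False
    then have "A = 0" using AB by simp
    have "I \<le> 0"
    proof (rule ccontr)
      assume "\<not> I \<le> 0"
      then have pos: "I > 0" "B\<^sup>2 + 1 > 0" by (auto simp: add_nonneg_pos)
      then have "2 * I \<le> I * (B\<^sup>2 / (B\<^sup>2 + 1))"
        using *[of "(B\<^sup>2 + 1) / I"] \<open>A = 0\<close> by (simp add: mult.commute)
      also have "\<dots> \<le> I * 1"
        using pos by (intro mult_left_mono) auto
      finally show False using pos by simp
    qed
    then show ?thesis using \<open>A = 0\<close> by simp
  qed
  then show ?thesis by (simp add: A_def B_def I_def)
qed

lemma l2_inner_tendsto:
  assumes lim: "l2_tendsto F f l G" and g: "g \<in> l2_space F"
  shows "((\<lambda>i. l2_inner F (f i) g) \<longlongrightarrow> l2_inner F l g) G"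
proof -
  have l: "l \<in> l2_space F" and ev: "\<forall>\<^sub>F i in G. f i \<in> l2_space F"
    and nrm: "((\<lambda>i. l2_norm F (\<lambda>x. f i x - l x)) \<longlongrightarrow> 0) G"
    using lim by (auto simp: l2_tendsto_def)
  have "((\<lambda>i. l2_inner F (f i) g - l2_inner F l g) \<longlongrightarrow> 0) G"
  proof (rule Lim_null_comparison)
    show "((\<lambda>i. l2_norm F (\<lambda>x. f i x - l x) * l2_norm F g) \<longlongrightarrow> 0) G"
      using tendsto_mult_left_zero[OF nrm] by simp
    show "\<forall>\<^sub>F i in G. norm (l2_inner F (f i) g - l2_inner F l g)
        \<le> l2_norm F (\<lambda>x. f i x - l x) * l2_norm F g"
      using ev
    proof eventually_elim
      case (elim i)
      then show ?case using l2_inner_diff[OF elim l g] l2_cauchy_schwarz[OF l2_space_diff[OF elim l] g]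
        by simp
    qed
  qed
  then show ?thesis using LIM_zero_iff by blast
qed

lemma l2_tendsto_cong_limit:
  assumes lim: "l2_tendsto F f l G" and l': "l' \<in> l2_space F"
    and ae: "AE x in lebesgue_on F. l x = l' x"
  shows "l2_tendsto F f l' G"
proof -
  have l: "l \<in> l2_space F" and ev: "\<forall>\<^sub>F i in G. f i \<in> l2_space F"
    using lim by (auto simp: l2_tendsto_def)
  have "l2_norm F (\<lambda>x. f i x - l x) = l2_norm F (\<lambda>x. f i x - l' x)" if "f i \<in> l2_space F" for i
    unfolding l2_norm_def
  proof (intro arg_cong[where f=sqrt] integral_cong_AE)
    show "(\<lambda>x. (cmod (f i x - l x))\<^sup>2) \<in> borel_measurable (lebesgue_on F)"
      using l2_spaceD(2)[OF l2_space_diff[OF that l]] by (rule borel_measurable_integrable)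
    show "(\<lambda>x. (cmod (f i x - l' x))\<^sup>2) \<in> borel_measurable (lebesgue_on F)"
      using l2_spaceD(2)[OF l2_space_diff[OF that l']] by (rule borel_measurable_integrable)
    show "AE x in lebesgue_on F. (cmod (f i x - l x))\<^sup>2 = (cmod (f i x - l' x))\<^sup>2"
      using ae by eventually_elim simp
  qed
  then have "\<forall>\<^sub>F i in G. l2_norm F (\<lambda>x. f i x - l x) = l2_norm F (\<lambda>x. f i x - l' x)"
    using ev by (auto elim: eventually_mono)
  then show ?thesis using lim l' by (auto simp: l2_tendsto_def dest: tendsto_cong)
qed

lemma l2_inner_commute: "l2_inner F f g = cnj (l2_inner F g f)"
proof -
  have "cnj (l2_inner F g f) = (LINT x|lebesgue_on F. cnj (g x * cnj (f x)))"
    unfolding l2_inner_def by (rule Bochner_Integration.integral_cnj[symmetric])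
  then show ?thesis by (simp add: l2_inner_def mult.commute)
qed

text \<open>The crude bound \<open>\<parallel>f + g\<parallel>\<^sup>2 \<le> 2 \<parallel>f\<parallel>\<^sup>2 + 2 \<parallel>g\<parallel>\<^sup>2\<close> replaces the triangle inequality.\<close>

lemma l2_tendsto_diff_scale:
  assumes f: "l2_tendsto F f l G" and g: "l2_tendsto F g l' G"
  shows "l2_tendsto F (\<lambda>i x. f i x - c * g i x) (\<lambda>x. l x - c * l' x) G"
proof -
  note f' = f[unfolded l2_tendsto_def] and g' = g[unfolded l2_tendsto_def]
  define A where "A = (\<lambda>i. l2_norm F (\<lambda>x. f i x - l x))"
  define B where "B = (\<lambda>i. l2_norm F (\<lambda>x. g i x - l' x))"
  have bound: "l2_norm F (\<lambda>x. f i x - c * g i x - (l x - c * l' x))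
      \<le> sqrt (2 * (A i)\<^sup>2 + 2 * ((cmod c)\<^sup>2 * (B i)\<^sup>2))"
    if i: "f i \<in> l2_space F" "g i \<in> l2_space F" for i
  proof -
    have d: "(\<lambda>x. f i x - l x) \<in> l2_space F" "(\<lambda>x. g i x - l' x) \<in> l2_space F"
      "(\<lambda>x. f i x - c * g i x - (l x - c * l' x)) \<in> l2_space F"
      using i f' g' by (auto intro!: l2_space_diff l2_space_scale)
    have "(LINT x|lebesgue_on F. (cmod (f i x - c * g i x - (l x - c * l' x)))\<^sup>2)
        \<le> (LINT x|lebesgue_on F. 2 * (cmod (f i x - l x))\<^sup>2 + 2 * ((cmod c)\<^sup>2 * (cmod (g i x - l' x))\<^sup>2))"
    proof (rule integral_mono)
      fix x
      define a b where "a = cmod (f i x - l x)" and "b = cmod (c * (g i x - l' x))"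
      have "cmod (f i x - c * g i x - (l x - c * l' x)) = cmod ((f i x - l x) - c * (g i x - l' x))"
        by (simp add: algebra_simps)
      also have "\<dots> \<le> a + b" unfolding a_def b_def by (rule norm_triangle_ineq4)
      finally have "(cmod (f i x - c * g i x - (l x - c * l' x)))\<^sup>2 \<le> (a + b)\<^sup>2"
        by (intro power_mono) auto
      also have "\<dots> \<le> 2 * a\<^sup>2 + 2 * b\<^sup>2"
        using sum_squares_bound[of a b] by (simp add: power2_sum)
      finally show "(cmod (f i x - c * g i x - (l x - c * l' x)))\<^sup>2
          \<le> 2 * (cmod (f i x - l x))\<^sup>2 + 2 * ((cmod c)\<^sup>2 * (cmod (g i x - l' x))\<^sup>2)"
        by (simp add: a_def b_def norm_mult power_mult_distrib)
    qed (use l2_spaceD(2)[OF d(1)] l2_spaceD(2)[OF d(2)] l2_spaceD(2)[OF d(3)] in auto)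
    also have "\<dots> = 2 * (A i)\<^sup>2 + 2 * ((cmod c)\<^sup>2 * (B i)\<^sup>2)"
      unfolding A_def B_def l2_norm_power2
      using l2_spaceD(2)[OF d(1)] l2_spaceD(2)[OF d(2)] by simp
    finally show ?thesis unfolding l2_norm_def by (rule real_sqrt_le_mono)
  qed
  have "((\<lambda>i. sqrt (2 * (A i)\<^sup>2 + 2 * ((cmod c)\<^sup>2 * (B i)\<^sup>2))) \<longlongrightarrow>
      sqrt (2 * 0\<^sup>2 + 2 * ((cmod c)\<^sup>2 * 0\<^sup>2))) G"
    using f' g' unfolding A_def B_def by (intro tendsto_intros) auto
  then have lim: "((\<lambda>i. sqrt (2 * (A i)\<^sup>2 + 2 * ((cmod c)\<^sup>2 * (B i)\<^sup>2))) \<longlongrightarrow> 0) G" by simp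
  have ev: "\<forall>\<^sub>F i in G. f i \<in> l2_space F \<and> g i \<in> l2_space F"
    using f' g' by (auto simp: eventually_conj_iff)
  have "((\<lambda>i. l2_norm F (\<lambda>x. f i x - c * g i x - (l x - c * l' x))) \<longlongrightarrow> 0) G"
  proof (rule Lim_null_comparison[OF _ lim])
    show "\<forall>\<^sub>F i in G. norm (l2_norm F (\<lambda>x. f i x - c * g i x - (l x - c * l' x)))
        \<le> sqrt (2 * (A i)\<^sup>2 + 2 * ((cmod c)\<^sup>2 * (B i)\<^sup>2))"
      using ev by eventually_elim (use bound in \<open>auto simp: l2_norm_nonneg\<close>)
  qed
  moreover have "\<forall>\<^sub>F i in G. (\<lambda>x. f i x - c * g i x) \<in> l2_space F"
    using ev by eventually_elim (auto intro: l2_space_diff l2_space_scale)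
  moreover have "(\<lambda>x. l x - c * l' x) \<in> l2_space F"
    using f' g' by (auto intro: l2_space_diff l2_space_scale)
  ultimately show ?thesis unfolding l2_tendsto_def by blast
qed

section \<open>Exponentials and the period cell\<close>

text \<open>The dual basis turns the parallelepiped, the lattice and its layers into conditions on single
  coordinates.\<close>

lemma exists_dual_basis:
  fixes w :: "'n::finite \<Rightarrow> real^'n"
  assumes inj: "inj w" and ind: "independent (range w)"
  shows "\<exists>d. (\<forall>i j. d i \<bullet> w j = (if i = j then 1 else 0)) \<and>
             (\<forall>x. x = (\<Sum>i\<in>UNIV. (d i \<bullet> x) *\<^sub>R w i))"
proof -
  obtain g where g: "linear g" "\<And>x. x \<in> range w \<Longrightarrow> g x = (axis (inv w x) 1 :: real^'n)"
    using linear_independent_extend[OF ind, of "\<lambda>x. axis (inv w x) 1"] by blast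
  define d where "d = (\<lambda>i. adjoint g (axis i 1))"
  have d: "d i \<bullet> w j = (if i = j then 1 else 0)" for i j
    using g inj by (simp add: d_def adjoint_works[OF g(1)] inner_axis_axis inner_commute)
  have "span (range w) = UNIV"
  proof -
    have "card (range w) = CARD('n)" using inj by (simp add: card_image)
    then have "UNIV \<subseteq> span (range w)" using ind
      by (intro card_ge_dim_independent) auto
    then show ?thesis by auto
  qed
  then have span: "x \<in> span (range w)" for x by simp
  have "x = (\<Sum>i\<in>UNIV. (d i \<bullet> x) *\<^sub>R w i)" for x
    using span[of x]
  proof (induction rule: span_induct_alt)
    case (step c x y)
    then obtain j where j: "x = w j" by auto
    have "(\<Sum>i\<in>UNIV. (d i \<bullet> (c *\<^sub>R x + y)) *\<^sub>R w i)
        = c *\<^sub>R (\<Sum>i\<in>UNIV. (d i \<bullet> x) *\<^sub>R w i) + (\<Sum>i\<in>UNIV. (d i \<bullet> y) *\<^sub>R w i)"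
      by (simp add: inner_add_right scaleR_add_left sum.distrib scaleR_sum_right)
    also have "(\<Sum>i\<in>UNIV. (d i \<bullet> x) *\<^sub>R w i) = (\<Sum>i\<in>UNIV. if j = i then w i else 0)"
      unfolding j by (intro sum.cong) (auto simp: d)
    finally show ?case using step.IH by (simp add: j)
  qed simp
  then show ?thesis using d by blast
qed

definition periodic :: "(real^'n::finite) set \<Rightarrow> (real^'n \<Rightarrow> complex) \<Rightarrow> bool"
  where "periodic \<Omega> h \<longleftrightarrow> (\<forall>x. \<forall>\<omega>\<in>\<Omega>. h (x + \<omega>) = h x)"

lemma expi_add_left: "expi (\<alpha> + \<beta>) x = expi \<alpha> x * expi \<beta> x"
  by (simp add: expi_def inner_add_left cis_mult)

lemma expi_add_right: "expi \<alpha> (x + y) = expi \<alpha> x * expi \<alpha> y"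
  by (simp add: expi_def inner_add_right cis_mult)

lemma expi_diff_left: "expi (\<alpha> - \<beta>) x = expi \<alpha> x * cnj (expi \<beta> x)"
  by (simp add: expi_def inner_diff_left cis_cnj cis_mult)

lemma norm_expi [simp]: "cmod (expi \<alpha> x) = 1"
  by (simp add: expi_def)

lemma expi_mult_cnj_self [simp]: "expi \<alpha> x * cnj (expi \<alpha> x) = 1"
  by (simp add: expi_def cis_cnj cis_mult)

lemma continuous_on_expi [continuous_intros]: "continuous_on S (expi \<alpha>)"
  unfolding expi_def cis_conv_exp by (intro continuous_intros)

locale lattice_cell =
  fixes w :: "'n::finite \<Rightarrow> real^'n" and \<Omega> F :: "(real^'n) set"
  assumes basis: "lattice_basis w \<Omega>"
    and F_eq: "F = fundamental_domain w"
    and measure_F: "measure lebesgue F = 1"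
begin

text \<open>The dual basis of \<open>w\<close>: \<open>coord i \<bullet> x\<close> is the \<open>i\<close>-th coordinate of \<open>x\<close>.\<close>

definition coord :: "'n \<Rightarrow> real^'n" where
  "coord = (SOME d. (\<forall>i j. d i \<bullet> w j = (if i = j then 1 else 0)) \<and>
     (\<forall>x. x = (\<Sum>i\<in>UNIV. (d i \<bullet> x) *\<^sub>R w i)))"

lemma coord_basis: "coord i \<bullet> w j = (if i = j then 1 else 0)"
  and coord_expansion: "(\<Sum>i\<in>UNIV. (coord i \<bullet> x) *\<^sub>R w i) = x"
proof -
  have "\<exists>d. (\<forall>i j. d i \<bullet> w j = (if i = j then 1 else 0)) \<and>
             (\<forall>x. x = (\<Sum>i\<in>UNIV. (d i \<bullet> x) *\<^sub>R w i))"
    using basis by (intro exists_dual_basis) (auto simp: lattice_basis_def)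
  from someI_ex[OF this] have *: "(\<forall>i j. coord i \<bullet> w j = (if i = j then 1 else 0)) \<and>
             (\<forall>x. x = (\<Sum>i\<in>UNIV. (coord i \<bullet> x) *\<^sub>R w i))"
    unfolding coord_def .
  show "coord i \<bullet> w j = (if i = j then 1 else 0)" using * by blast
  show "(\<Sum>i\<in>UNIV. (coord i \<bullet> x) *\<^sub>R w i) = x" using * by metis
qed

lemma coord_sum: "coord j \<bullet> (\<Sum>i\<in>UNIV. s i *\<^sub>R w i) = s j"
  by (simp add: inner_sum_right coord_basis if_distrib sum.delta cong: if_cong)

lemma F_coord: "F = {x. \<forall>i. 0 \<le> coord i \<bullet> x \<and> coord i \<bullet> x < 1}"
proof (intro set_eqI iffI)
  fix x assume "x \<in> F"
  then show "x \<in> {x. \<forall>i. 0 \<le> coord i \<bullet> x \<and> coord i \<bullet> x < 1}"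
    by (auto simp: F_eq fundamental_domain_def coord_sum)
next
  fix x assume x: "x \<in> {x. \<forall>i. 0 \<le> coord i \<bullet> x \<and> coord i \<bullet> x < 1}"
  then show "x \<in> F"
    unfolding F_eq fundamental_domain_def
    by (intro CollectI exI[of _ "\<lambda>i. coord i \<bullet> x"]) (auto simp: coord_expansion)
qed

lemma Omega_iff: "x \<in> \<Omega> \<longleftrightarrow> (\<forall>i. coord i \<bullet> x \<in> \<int>)"
proof
  assume "x \<in> \<Omega>"
  then show "\<forall>i. coord i \<bullet> x \<in> \<int>"
    using basis by (auto simp: lattice_basis_def int_span_def coord_sum)
next
  assume "\<forall>i. coord i \<bullet> x \<in> \<int>"
  then have "coord i \<bullet> x = real_of_int \<lfloor>coord i \<bullet> x\<rfloor>" for i by (metis Ints_cases floor_of_int)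
  then have "x = (\<lambda>c. \<Sum>i\<in>UNIV. real_of_int (c i) *\<^sub>R w i) (\<lambda>i. \<lfloor>coord i \<bullet> x\<rfloor>)"
    using coord_expansion[of x] by simp
  then have "x \<in> range (\<lambda>c. \<Sum>i\<in>UNIV. real_of_int (c i) *\<^sub>R w i)"
    by (rule image_eqI[where f = "\<lambda>c. \<Sum>i\<in>UNIV. real_of_int (c i) *\<^sub>R w i"]) (rule UNIV_I)
  then show "x \<in> \<Omega>"
    using basis by (simp add: lattice_basis_def int_span_def)
qed

lemma dual_coord: "(2 * pi) *\<^sub>R coord i \<in> dual_lattice \<Omega>"
proof -
  have "\<exists>z::int. ((2 * pi) *\<^sub>R coord i) \<bullet> \<omega> = 2 * pi * real_of_int z" if "\<omega> \<in> \<Omega>" for \<omega>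
  proof -
    have "coord i \<bullet> \<omega> \<in> \<int>" using that by (simp add: Omega_iff)
    then obtain z where "coord i \<bullet> \<omega> = real_of_int z" by (rule Ints_cases)
    then show ?thesis by (intro exI[of _ z]) simp
  qed
  then show ?thesis by (simp add: dual_lattice_def)
qed

lemma exists_cell_shift: "\<exists>\<omega>\<in>\<Omega>. x - \<omega> \<in> F"
proof
  define \<omega> where "\<omega> = (\<Sum>i\<in>UNIV. real_of_int \<lfloor>coord i \<bullet> x\<rfloor> *\<^sub>R w i)"
  show "\<omega> \<in> \<Omega>" by (simp add: Omega_iff \<omega>_def coord_sum)
  have "x - \<omega> \<in> {x. \<forall>i. 0 \<le> coord i \<bullet> x \<and> coord i \<bullet> x < 1}"
    by (simp add: \<omega>_def inner_diff_right coord_sum)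
       (metis floor_less_iff frac_lt_1 frac_def)
  then show "x - \<omega> \<in> F" by (simp add: F_coord)
qed

text \<open>A set that is not measurable or has infinite measure would have \<^const>\<open>measure\<close> 0 by convention.\<close>

lemma F_lmeasurable: "F \<in> lmeasurable"
proof (rule fmeasurableI)
  show "F \<in> sets lebesgue" using measure_F measure_notin_sets[of F lebesgue] by force
  have "emeasure lebesgue F \<noteq> \<infinity>" using measure_F by (auto simp: measure_def)
  then show "emeasure lebesgue F < \<infinity>" by (simp add: less_top)
qed

lemma F_borel [measurable]: "F \<in> sets borel"
proof -
  have "F = (\<Inter>i. {x. 0 \<le> coord i \<bullet> x} \<inter> {x. coord i \<bullet> x < 1})"
    by (auto simp: F_coord)
  also have "\<dots> \<in> sets borel"
    by (intro sets.countable_INT' sets.Int borel_closed borel_open closed_halfspace_component_ge)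
       (auto intro: closed_halfspace_ge open_halfspace_lt)
  finally show ?thesis .
qed

lemma bounded_F: "bounded F"
proof -
  have "norm x \<le> (\<Sum>i\<in>UNIV. norm (w i))" if "x \<in> F" for x
  proof -
    have "norm x = norm (\<Sum>i\<in>UNIV. (coord i \<bullet> x) *\<^sub>R w i)" by (simp add: coord_expansion)
    also have "\<dots> \<le> (\<Sum>i\<in>UNIV. norm ((coord i \<bullet> x) *\<^sub>R w i))" by (rule norm_sum)
    also have "\<dots> \<le> (\<Sum>i\<in>UNIV. norm (w i))"
    proof (rule sum_mono)
      fix i
      have "\<bar>coord i \<bullet> x\<bar> \<le> 1" using that by (auto simp: F_coord) (smt (verit))
      then show "norm ((coord i \<bullet> x) *\<^sub>R w i) \<le> norm (w i)"
        by (simp add: mult_left_le_one_le)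
    qed
    finally show ?thesis .
  qed
  then show ?thesis by (auto simp: bounded_iff)
qed

lemma finite_measure_F: "finite_measure (lebesgue_on F)"
  by (rule finite_measure_lebesgue_on[OF F_lmeasurable])

lemma F_sets_lebesgue: "F \<inter> space lebesgue \<in> sets lebesgue"
  using F_lmeasurable by (auto simp: fmeasurable_def)

lemma measurable_continuous:
  assumes "continuous_on UNIV h"
  shows "h \<in> borel_measurable (lebesgue_on F)"
proof -
  have "h \<in> borel_measurable borel" using assms by (rule borel_measurable_continuous_onI)
  then have "h \<in> borel_measurable lebesgue"
    by (simp add: measurable_completion)
  then show ?thesis by (rule measurable_restrict_space1)
qed

lemma continuous_bounded_F:
  fixes h :: "real^'n \<Rightarrow> complex"
  assumes "continuous_on UNIV h"
  shows "\<exists>B. \<forall>x\<in>F. norm (h x) \<le> B"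
proof -
  have "compact (h ` closure F)"
    using bounded_F assms by (intro compact_continuous_image) (auto intro: continuous_on_subset)
  then have "bounded (h ` F)"
    by (meson bounded_subset closure_subset compact_imp_bounded image_mono)
  then show ?thesis by (auto simp: bounded_iff)
qed

lemma integrable_continuous:
  fixes h :: "real^'n \<Rightarrow> complex"
  assumes "continuous_on UNIV h"
  shows "integrable (lebesgue_on F) h"
proof -
  obtain B where "\<forall>x\<in>F. norm (h x) \<le> B" using continuous_bounded_F[OF assms] by blast
  then show ?thesis
    using measurable_continuous[OF assms]
    by (intro finite_measure.integrable_const_bound[OF finite_measure_F, of _ B])
       (auto intro!: AE_I2)
qed

lemma l2_space_continuous:
  fixes h :: "real^'n \<Rightarrow> complex"
  assumes h: "continuous_on UNIV h"
  shows "h \<in> l2_space F"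
proof -
  have "integrable (lebesgue_on F) (\<lambda>x. h x * cnj (h x))"
    by (intro integrable_continuous continuous_intros h)
  then have "integrable (lebesgue_on F) (\<lambda>x. Re (h x * cnj (h x)))"
    by (rule integrable_Re)
  moreover have "Re (h x * cnj (h x)) = (cmod (h x))\<^sup>2" for x
    by (simp add: complex_norm_square[symmetric] flip: of_real_power)
  ultimately show ?thesis using measurable_continuous[OF h] by (simp add: l2_space_def)
qed

lemma expi_l2: "expi \<alpha> \<in> l2_space F"
  by (intro l2_space_continuous continuous_intros)

lemma l2_norm_le_sup:
  assumes f: "f \<in> l2_space F" and bound: "\<And>x. x \<in> F \<Longrightarrow> cmod (f x) \<le> B"
  shows "l2_norm F f \<le> B"
proof -
  interpret finite_measure "lebesgue_on F" by (rule finite_measure_F)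
  have "F \<noteq> {}" using measure_F by auto
  then have B: "B \<ge> 0" using bound norm_ge_zero order_trans by blast
  have "(LINT x|lebesgue_on F. (cmod (f x))\<^sup>2) \<le> (LINT x|lebesgue_on F. B\<^sup>2)"
    using l2_spaceD(2)[OF f] bound by (intro integral_mono) (auto intro: power_mono)
  also have "\<dots> = B\<^sup>2"
    using measure_F F_sets_lebesgue by (simp add: measure_restrict_space)
  finally have "l2_norm F f \<le> sqrt (B\<^sup>2)" unfolding l2_norm_def by (rule real_sqrt_le_mono)
  then show ?thesis using B by simp
qed

lemma integral_F_eq_lborel:
  fixes h :: "real^'n \<Rightarrow> complex"
  assumes "continuous_on UNIV h"
  shows "(LINT x|lebesgue_on F. h x) = (LINT x|lborel. indicator F x *\<^sub>R h x)"
proof -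
  have [measurable]: "h \<in> borel_measurable borel" using assms by (rule borel_measurable_continuous_onI)
  show ?thesis
    using F_sets_lebesgue by (simp add: integral_restrict_space integral_completion)
qed

lemma lborel_integral_translate:
  fixes f :: "real^'n \<Rightarrow> complex"
  assumes "f \<in> borel_measurable borel"
  shows "(LINT x|lborel. f (x + c)) = (LINT x|lborel. f x)"
proof -
  have "(LINT x|lborel. f x) = (LINT x|distr lborel borel ((+) c). f x)"
    by (simp add: lborel_distr_plus)
  also have "\<dots> = (LINT x|lborel. f (c + x))"
    using assms by (intro integral_distr) auto
  finally show ?thesis by (simp add: add.commute)
qed

lemma integrable_lborel_subset:
  fixes h :: "real^'n \<Rightarrow> complex"
  assumes h: "continuous_on UNIV h" and A: "A \<in> sets borel" "bounded A"
  shows "integrable lborel (\<lambda>x. indicator A x *\<^sub>R h x)"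
proof (rule Bochner_Integration.integrable_bound)
  show "integrable lborel (\<lambda>x. indicator (closure A) x *\<^sub>R h x)"
    using A h by (intro borel_integrable_compact) (auto intro: continuous_on_subset)
  have [measurable]: "h \<in> borel_measurable borel" using h by (rule borel_measurable_continuous_onI)
  show "(\<lambda>x. indicator A x *\<^sub>R h x) \<in> borel_measurable lborel" using A by simp
  show "AE x in lborel. norm (indicator A x *\<^sub>R h x) \<le> norm (indicator (closure A) x *\<^sub>R h x)"
    using closure_subset[of A] by (intro AE_I2) (auto simp: indicator_def)
qed

text \<open>Cut the cell at the coordinate value \<open>1 - s\<close>. The shift by \<open>s *\<^sub>R w i\<close> moves the lower part into
  the cell and the upper part out of it; moving the upper part back by the period \<open>w i\<close> makes the
  two images tile the cell again.\<close>

lemma integral_shift_basis: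
  fixes h :: "real^'n \<Rightarrow> complex"
  assumes h: "continuous_on UNIV h" and per: "periodic \<Omega> h" and s: "0 \<le> s" "s < 1"
  shows "(LINT x|lebesgue_on F. h (x + s *\<^sub>R w i)) = (LINT x|lebesgue_on F. h x)"
proof -
  define A where "A = F \<inter> {x. coord i \<bullet> x < 1 - s}"
  define B where "B = F \<inter> {x. coord i \<bullet> x \<ge> 1 - s}"
  have A: "A \<in> sets borel" "bounded A" and B: "B \<in> sets borel" "bounded B"
    unfolding A_def B_def using bounded_F
    by (auto intro: bounded_subset borel_open borel_closed open_halfspace_lt closed_halfspace_ge)
  note [measurable] = A(1) B(1)
  have [measurable]: "h \<in> borel_measurable borel" using h by (rule borel_measurable_continuous_onI)
  have wi: "w i \<in> \<Omega>" by (simp add: Omega_iff coord_basis)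
  have hper: "h (x + (s - 1) *\<^sub>R w i) = h (x + s *\<^sub>R w i)" for x
  proof -
    have "h (x + (s - 1) *\<^sub>R w i) = h (x + (s - 1) *\<^sub>R w i + w i)"
      using per wi by (simp add: periodic_def)
    moreover have "x + (s - 1) *\<^sub>R w i + w i = x + s *\<^sub>R w i"
      by (simp add: scaleR_left_diff_distrib)
    ultimately show ?thesis by simp
  qed
  have cA: "continuous_on UNIV (\<lambda>x. h (x + c))" for c
    by (rule continuous_on_compose2[OF h]) (auto intro!: continuous_intros)
  have int: "integrable lborel (\<lambda>x. indicator C x *\<^sub>R h (x + c))" if "C = A \<or> C = B" for C c
    using that A B cA by (intro integrable_lborel_subset) auto
  have shifted: "integrable lborel (\<lambda>x. indicator C (x - c) *\<^sub>R h x)" if C: "C = A \<or> C = B" for C c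
  proof -
    have "C \<in> sets borel" "bounded C" using C A B by auto
    then have "bounded ((+) c ` C)" by (simp add: bounded_translation)
    moreover have "(+) c ` C = (\<lambda>x. x - c) -` C \<inter> space borel"
    proof (intro set_eqI iffI)
      fix x assume "x \<in> (\<lambda>x. x - c) -` C \<inter> space borel"
      then show "x \<in> (+) c ` C" by (intro image_eqI[of _ _ "x - c"]) auto
    qed auto
    moreover have "\<dots> \<in> sets borel"
      by (rule measurable_sets) (use \<open>C \<in> sets borel\<close> in auto)
    ultimately have "integrable lborel (\<lambda>x. indicator ((+) c ` C) x *\<^sub>R h x)"
      using h by (intro integrable_lborel_subset) auto
    moreover have "indicator ((+) c ` C) x = (indicator C (x - c) :: real)" for x
    proof -
      have "x \<in> (+) c ` C \<longleftrightarrow> x - c \<in> C"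
        by (auto intro: image_eqI[of _ _ "x - c"])
      then show ?thesis by (simp add: indicator_def)
    qed
    ultimately show ?thesis by simp
  qed
  have "(LINT x|lebesgue_on F. h (x + s *\<^sub>R w i))
      = (LINT x|lborel. indicator F x *\<^sub>R h (x + s *\<^sub>R w i))"
    by (rule integral_F_eq_lborel[OF cA])
  also have "\<dots> = (LINT x|lborel. indicator A x *\<^sub>R h (x + s *\<^sub>R w i)
                             + indicator B x *\<^sub>R h (x + (s - 1) *\<^sub>R w i))"
    by (intro Bochner_Integration.integral_cong refl) (auto simp: A_def B_def indicator_def hper)
  also have "\<dots> = (LINT x|lborel. indicator A x *\<^sub>R h (x + s *\<^sub>R w i))
      + (LINT x|lborel. indicator B x *\<^sub>R h (x + (s - 1) *\<^sub>R w i))"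
    by (intro Bochner_Integration.integral_add int) auto
  also have "(LINT x|lborel. indicator A x *\<^sub>R h (x + s *\<^sub>R w i))
      = (LINT x|lborel. indicator A (x - s *\<^sub>R w i) *\<^sub>R h x)"
    using lborel_integral_translate[of "\<lambda>x. indicator A (x - s *\<^sub>R w i) *\<^sub>R h x" "s *\<^sub>R w i"] by simp
  also have "(LINT x|lborel. indicator B x *\<^sub>R h (x + (s - 1) *\<^sub>R w i))
      = (LINT x|lborel. indicator B (x - (s - 1) *\<^sub>R w i) *\<^sub>R h x)"
    using lborel_integral_translate[of "\<lambda>x. indicator B (x - (s - 1) *\<^sub>R w i) *\<^sub>R h x" "(s - 1) *\<^sub>R w i"]
    by simp
  also have "(LINT x|lborel. indicator A (x - s *\<^sub>R w i) *\<^sub>R h x)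
      + (LINT x|lborel. indicator B (x - (s - 1) *\<^sub>R w i) *\<^sub>R h x)
      = (LINT x|lborel. indicator A (x - s *\<^sub>R w i) *\<^sub>R h x
          + indicator B (x - (s - 1) *\<^sub>R w i) *\<^sub>R h x)"
    by (intro Bochner_Integration.integral_add[symmetric] shifted) auto
  also have "\<dots> = (LINT x|lborel. indicator F x *\<^sub>R h x)"
  proof (intro Bochner_Integration.integral_cong refl)
    fix x
    have cj: "coord j \<bullet> (x - r *\<^sub>R w i) = coord j \<bullet> x - (if j = i then r else 0)" for j r
      by (simp add: inner_diff_right coord_basis)
    have Fi: "x - r *\<^sub>R w i \<in> F \<longleftrightarrow> (\<forall>j. j \<noteq> i \<longrightarrow> 0 \<le> coord j \<bullet> x \<and> coord j \<bullet> x < 1) \<and>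
        0 \<le> coord i \<bullet> x - r \<and> coord i \<bullet> x - r < 1" for r
    proof -
      have F: "x - r *\<^sub>R w i \<in> F \<longleftrightarrow> (\<forall>j. 0 \<le> coord j \<bullet> x - (if j = i then r else 0) \<and>
          coord j \<bullet> x - (if j = i then r else 0) < 1)"
        by (simp only: F_coord mem_Collect_eq cj)
      show ?thesis unfolding F
      proof (intro iffI conjI allI impI, goal_cases)
        case (1 j) then show ?case by (auto dest: spec[of _ j])
      next
        case (2 j) then show ?case by (auto dest: spec[of _ j])
      next
        case 3 then show ?case by (auto dest: spec[of _ i])
      next
        case 4 then show ?case by (auto dest: spec[of _ i])
      qed (auto split: if_splits)
    qed
    have F0: "x \<in> F \<longleftrightarrow> (\<forall>j. j \<noteq> i \<longrightarrow> 0 \<le> coord j \<bullet> x \<and> coord j \<bullet> x < 1) \<and>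
        0 \<le> coord i \<bullet> x \<and> coord i \<bullet> x < 1"
      using Fi[of 0] by simp
    have inA: "x - s *\<^sub>R w i \<in> A \<longleftrightarrow> x \<in> F \<and> coord i \<bullet> x \<ge> s"
    proof -
      have "x - s *\<^sub>R w i \<in> A \<longleftrightarrow> x - s *\<^sub>R w i \<in> F \<and> coord i \<bullet> x - s < 1 - s"
        by (simp add: A_def cj)
      then show ?thesis using s unfolding F0 Fi[of s] by auto
    qed
    have inB: "x - (s - 1) *\<^sub>R w i \<in> B \<longleftrightarrow> x \<in> F \<and> coord i \<bullet> x < s"
    proof -
      have "x - (s - 1) *\<^sub>R w i \<in> B \<longleftrightarrow>
          x - (s - 1) *\<^sub>R w i \<in> F \<and> coord i \<bullet> x - (s - 1) \<ge> 1 - s"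
        by (simp add: B_def cj)
      then show ?thesis using s unfolding F0 Fi[of "s - 1"] by auto
    qed
    show "indicator A (x - s *\<^sub>R w i) *\<^sub>R h x + indicator B (x - (s - 1) *\<^sub>R w i) *\<^sub>R h x
        = indicator F x *\<^sub>R h x"
      using inA inB by (auto simp: indicator_def)
  qed
  also have "\<dots> = (LINT x|lebesgue_on F. h x)"
    by (rule integral_F_eq_lborel[OF h, symmetric])
  finally show ?thesis .
qed

text \<open>Reduce to shifts along single basis vectors: the integer parts of the coordinates of \<open>y\<close> are
  absorbed by periodicity, the fractional parts are treated one basis vector at a time.\<close>

lemma integral_shift:
  fixes h :: "real^'n \<Rightarrow> complex"
  assumes h: "continuous_on UNIV h" and per: "periodic \<Omega> h"
  shows "(LINT x|lebesgue_on F. h (x + y)) = (LINT x|lebesgue_on F. h x)"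
proof -
  define r where "r = (\<lambda>i. frac (coord i \<bullet> y))"
  have part: "(LINT x|lebesgue_on F. h (x + (\<Sum>i\<in>I. r i *\<^sub>R w i))) = (LINT x|lebesgue_on F. h x)"
    if "finite I" for I
    using that
  proof (induction I)
    case (insert j I)
    define h' where "h' = (\<lambda>x. h (x + (\<Sum>i\<in>I. r i *\<^sub>R w i)))"
    have "continuous_on UNIV h'" unfolding h'_def
      by (rule continuous_on_compose2[OF h]) (auto intro!: continuous_intros)
    moreover have "periodic \<Omega> h'" using per unfolding periodic_def h'_def
      by (metis (no_types, lifting) add.assoc add.commute)
    ultimately have "(LINT x|lebesgue_on F. h' (x + r j *\<^sub>R w j)) = (LINT x|lebesgue_on F. h' x)"
      by (rule integral_shift_basis) (auto simp: r_def frac_lt_1)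
    then show ?case using insert by (simp add: h'_def add.assoc)
  qed simp
  define \<omega> where "\<omega> = (\<Sum>i\<in>UNIV. real_of_int \<lfloor>coord i \<bullet> y\<rfloor> *\<^sub>R w i)"
  have om: "\<omega> \<in> \<Omega>" by (simp add: Omega_iff \<omega>_def coord_sum)
  have "y = (\<Sum>i\<in>UNIV. (coord i \<bullet> y) *\<^sub>R w i)" by (simp add: coord_expansion)
  also have "\<dots> = (\<Sum>i\<in>UNIV. r i *\<^sub>R w i) + \<omega>"
    by (simp add: \<omega>_def r_def frac_def flip: sum.distrib scaleR_add_left)
  finally have y: "y = (\<Sum>i\<in>UNIV. r i *\<^sub>R w i) + \<omega>" .
  have "h (x + y) = h (x + (\<Sum>i\<in>UNIV. r i *\<^sub>R w i))" for x
    using per om unfolding y periodic_def by (simp add: add.assoc[symmetric])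
  then show ?thesis using part[of UNIV] by simp
qed

lemma expi_dual_periodic:
  assumes "\<gamma> \<in> dual_lattice \<Omega>" "\<omega> \<in> \<Omega>"
  shows "expi \<gamma> \<omega> = 1"
  using assms by (auto simp: dual_lattice_def expi_def cis.code complex_eq_iff cos_int_2pin sin_int_2pin)

lemma periodic_expi: "\<gamma> \<in> dual_lattice \<Omega> \<Longrightarrow> periodic \<Omega> (expi \<gamma>)"
  by (simp add: periodic_def expi_add_right expi_dual_periodic)

text \<open>For \<open>\<gamma> = \<alpha> - \<beta> \<noteq> 0\<close>, a shift by \<open>y\<close> with \<open>\<gamma> \<bullet> y = \<pi>\<close> changes the sign of the
  integrand but not the integral, which is therefore 0.\<close>

lemma expi_orthonormal:
  assumes \<alpha>: "\<alpha> - \<beta> \<in> dual_lattice \<Omega>"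
  shows "l2_inner F (expi \<alpha>) (expi \<beta>) = (if \<alpha> = \<beta> then 1 else 0)"
proof (cases "\<alpha> = \<beta>")
  case True
  then show ?thesis
    using measure_F F_sets_lebesgue finite_measure_F
    by (simp add: l2_inner_def measure_restrict_space finite_measure.emeasure_eq_measure)
next
  case False
  define \<gamma> where "\<gamma> = \<alpha> - \<beta>"
  define y where "y = (pi / (norm \<gamma>)\<^sup>2) *\<^sub>R \<gamma>"
  have "expi \<gamma> y = cis pi" using False by (simp add: y_def \<gamma>_def expi_def power2_norm_eq_inner)
  then have y: "expi \<gamma> (x + y) = - expi \<gamma> x" for x by (simp add: expi_add_right)
  have "(LINT x|lebesgue_on F. expi \<gamma> (x + y)) = (LINT x|lebesgue_on F. expi \<gamma> x)"
    using \<alpha> by (intro integral_shift continuous_intros periodic_expi) (simp add: \<gamma>_def)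
  then have "(LINT x|lebesgue_on F. expi \<gamma> x) = 0" by (simp add: y)
  then show ?thesis using False by (simp add: l2_inner_def \<gamma>_def expi_diff_left)
qed

end

section \<open>The Laplacian on Fourier coefficients\<close>

context lattice_cell
begin

text \<open>The difference quotients of \<open>H\<close> in the direction \<open>e\<close> integrate to 0 by translation invariance.
  They converge pointwise to \<open>D\<close>, and by the mean value inequality they are dominated by a bound of
  \<open>D\<close> on the compact set swept out by the cell under shifts of length at most 1.\<close>

lemma integral_derivative_zero:
  fixes H D :: "real^'n \<Rightarrow> complex"
  assumes H: "continuous_on UNIV H" and D: "continuous_on UNIV D" and per: "periodic \<Omega> H"
    and der: "\<And>x. ((\<lambda>s. H (x + s *\<^sub>R e)) has_vector_derivative D x) (at 0)"
  shows "(LINT x|lebesgue_on F. D x) = 0"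
proof -
  have der': "((\<lambda>s. H (x + s *\<^sub>R e)) has_vector_derivative D (x + r *\<^sub>R e)) (at r)" for x r
  proof -
    have "((\<lambda>s. s - r) has_vector_derivative 1) (at r)"
      by (auto intro!: derivative_eq_intros)
    moreover have "((\<lambda>s. H ((x + r *\<^sub>R e) + s *\<^sub>R e)) has_vector_derivative D (x + r *\<^sub>R e)) (at (r - r))"
      using der[of "x + r *\<^sub>R e"] by simp
    ultimately have "((\<lambda>s. H ((x + r *\<^sub>R e) + s *\<^sub>R e)) \<circ> (\<lambda>s. s - r)
        has_vector_derivative 1 *\<^sub>R D (x + r *\<^sub>R e)) (at r)"
      by (rule vector_diff_chain_at)
    moreover have "(\<lambda>s. H ((x + r *\<^sub>R e) + s *\<^sub>R e)) \<circ> (\<lambda>s. s - r) = (\<lambda>s. H (x + s *\<^sub>R e))"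
    proof
      fix s
      have "(x + r *\<^sub>R e) + (s - r) *\<^sub>R e = x + s *\<^sub>R e"
        by (simp only: add.assoc scaleR_left_distrib[symmetric]) simp
      then show "((\<lambda>s. H ((x + r *\<^sub>R e) + s *\<^sub>R e)) \<circ> (\<lambda>s. s - r)) s = H (x + s *\<^sub>R e)"
        by (simp only: o_def)
    qed
    ultimately show ?thesis by (simp only: scaleR_one)
  qed
  define K where "K = (\<lambda>p. fst p + snd p *\<^sub>R e) ` (closure F \<times> {0..1::real})"
  have "compact K" unfolding K_def
  proof (rule compact_continuous_image)
    show "continuous_on (closure F \<times> {0..1}) (\<lambda>p. fst p + snd p *\<^sub>R e)"
      by (intro continuous_intros)
    show "compact (closure F \<times> {0..1::real})"
      using bounded_F by (intro compact_Times) auto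
  qed
  then have "compact (D ` K)"
    using D
    by (intro compact_continuous_image) (auto intro: continuous_on_subset)
  then have "bounded (D ` K)" by (rule compact_imp_bounded)
  then obtain B where B: "\<And>y. y \<in> K \<Longrightarrow> norm (D y) \<le> B"
    by (auto simp: bounded_iff)
  have quot: "norm (H (x + s *\<^sub>R e) - H x) \<le> B * s" if x: "x \<in> F" and s: "0 < s" "s \<le> 1" for x s
  proof -
    have "norm (H (x + s *\<^sub>R e) - H (x + 0 *\<^sub>R e)) \<le> B * norm (s - 0)"
    proof (rule differentiable_bound[where S = "{0..1}" and f = "\<lambda>s. H (x + s *\<^sub>R e)"])
      fix r :: real assume r: "r \<in> {0..1}"
      show "((\<lambda>s. H (x + s *\<^sub>R e)) has_derivative (\<lambda>h. h *\<^sub>R D (x + r *\<^sub>R e))) (at r within {0..1})"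
        using der'[of x r] unfolding has_vector_derivative_def by (rule has_derivative_at_withinI)
      have "x \<in> closure F" using x closure_subset by blast
      then have "(x, r) \<in> closure F \<times> {0..1}" using r by auto
      then have "fst (x, r) + snd (x, r) *\<^sub>R e \<in> K" unfolding K_def by (rule imageI)
      then have "x + r *\<^sub>R e \<in> K" by simp
      then have b: "norm (D (x + r *\<^sub>R e)) \<le> B" by (rule B)
      show "onorm (\<lambda>h. h *\<^sub>R D (x + r *\<^sub>R e)) \<le> B"
      proof (rule onorm_bound)
        show "0 \<le> B" using b norm_ge_zero order_trans by blast
        show "norm (h *\<^sub>R D (x + r *\<^sub>R e)) \<le> B * norm h" for h
          using mult_right_mono[OF b, of "\<bar>h\<bar>"] by (simp add: mult.commute)
      qed
    qed (use s in auto)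
    then show ?thesis using s by simp
  qed
  define u where "u = (\<lambda>(m::nat) x. (H (x + inverse (Suc m) *\<^sub>R e) - H x) / of_real (inverse (real (Suc m))))"
  have cH: "continuous_on UNIV (\<lambda>x. H (x + c))" for c
    by (rule continuous_on_compose2[OF H]) (auto intro!: continuous_intros)
  have zero: "(LINT x|lebesgue_on F. u m x) = 0" for m
  proof -
    have "(LINT x|lebesgue_on F. H (x + inverse (Suc m) *\<^sub>R e) - H x)
        = (LINT x|lebesgue_on F. H (x + inverse (Suc m) *\<^sub>R e)) - (LINT x|lebesgue_on F. H x)"
      by (intro Bochner_Integration.integral_diff integrable_continuous cH H)
    also have "\<dots> = 0" using integral_shift[OF H per] by simp
    finally show ?thesis unfolding u_def integral_divide_zero by (simp del: of_nat_Suc)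
  qed
  interpret finite_measure "lebesgue_on F" by (rule finite_measure_F)
  have "(\<lambda>m. LINT x|lebesgue_on F. u m x) \<longlonglongrightarrow> (LINT x|lebesgue_on F. D x)"
  proof (rule integral_dominated_convergence[where w = "\<lambda>x. B"])
    show "D \<in> borel_measurable (lebesgue_on F)" by (rule measurable_continuous[OF D])
    show "u m \<in> borel_measurable (lebesgue_on F)" for m
      unfolding u_def by (intro measurable_continuous continuous_intros cH H) (simp del: of_nat_Suc)
    show "AE x in lebesgue_on F. (\<lambda>m. u m x) \<longlonglongrightarrow> D x"
    proof (rule AE_I2)
      fix x
      have lim: "((\<lambda>s. (H (x + s *\<^sub>R e) - H x) / of_real s) \<longlongrightarrow> D x) (at 0)"
      proof -
        have "((\<lambda>s. norm (H (x + (0 + s) *\<^sub>R e) - H (x + 0 *\<^sub>R e) - s *\<^sub>R D x) / norm s) \<longlongrightarrow> 0) (at 0)"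
          using der[of x] unfolding has_vector_derivative_def has_derivative_at by blast
        moreover have "\<forall>\<^sub>F s in at 0. norm (H (x + (0 + s) *\<^sub>R e) - H (x + 0 *\<^sub>R e) - s *\<^sub>R D x) / norm s
            = norm ((H (x + s *\<^sub>R e) - H x) / of_real s - D x)"
          unfolding eventually_at_filter
        proof (intro always_eventually allI impI)
          fix s :: real assume "s \<noteq> 0"
          then have "(H (x + s *\<^sub>R e) - H x) / of_real s - D x
              = (H (x + s *\<^sub>R e) - H x - s *\<^sub>R D x) / of_real s"
            by (simp add: diff_divide_distrib scaleR_conv_of_real)
          then show "norm (H (x + (0 + s) *\<^sub>R e) - H (x + 0 *\<^sub>R e) - s *\<^sub>R D x) / norm s
            = norm ((H (x + s *\<^sub>R e) - H x) / of_real s - D x)"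
            by (simp add: norm_divide)
        qed
        ultimately have "((\<lambda>s. norm ((H (x + s *\<^sub>R e) - H x) / of_real s - D x)) \<longlongrightarrow> 0) (at 0)"
          by (rule Lim_transform_eventually)
        then show ?thesis by (rule LIM_zero_cancel[OF tendsto_norm_zero_cancel])
      qed
      have "filterlim (\<lambda>m. inverse (real (Suc m))) (at 0) sequentially"
        unfolding filterlim_at using LIMSEQ_inverse_real_of_nat by auto
      from filterlim_compose[OF lim this]
      show "(\<lambda>m. u m x) \<longlonglongrightarrow> D x" by (simp add: u_def)
    qed
    show "AE x in lebesgue_on F. norm (u m x) \<le> B" for m
    proof (rule AE_I2)
      fix x assume "x \<in> space (lebesgue_on F)"
      then have "x \<in> F" by simp
      define \<epsilon> where "\<epsilon> = inverse (real (Suc m))"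
      have \<epsilon>: "0 < \<epsilon>" "\<epsilon> \<le> 1" by (simp_all add: \<epsilon>_def inverse_le_1_iff)
      then have "norm (H (x + \<epsilon> *\<^sub>R e) - H x) / \<epsilon> \<le> B"
        using quot[OF \<open>x \<in> F\<close> \<epsilon>] by (simp only: pos_divide_le_eq)
      then show "norm (u m x) \<le> B"
        using \<epsilon>(1) unfolding u_def \<epsilon>_def[symmetric] norm_divide norm_of_real by simp
    qed
  qed simp
  then show ?thesis unfolding zero using LIMSEQ_unique tendsto_const by blast
qed

text \<open>The factors \<open>exp (i t \<bullet> \<omega>)\<close> cancel; so integrals against \<open>e\<^sub>\<gamma>\<close> are integrals of periodic
  functions.\<close>

lemma quasi_periodic_times_cnj_expi:
  assumes "quasi_periodic \<Omega> t \<Psi>" "\<gamma> \<in> dual_lattice \<Omega>"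
  shows "periodic \<Omega> (\<lambda>x. \<Psi> x * cnj (expi (\<gamma> + t) x))"
  unfolding periodic_def
proof (intro allI ballI)
  fix x \<omega> assume \<omega>: "\<omega> \<in> \<Omega>"
  have "expi (\<gamma> + t) (x + \<omega>) = expi (\<gamma> + t) x * cis (t \<bullet> \<omega>)"
    using expi_dual_periodic[OF assms(2) \<omega>]
    by (simp add: expi_add_right expi_add_left[of \<gamma> t \<omega>]) (simp add: expi_def)
  then show "\<Psi> (x + \<omega>) * cnj (expi (\<gamma> + t) (x + \<omega>)) = \<Psi> x * cnj (expi (\<gamma> + t) x)"
    using assms(1) \<omega> by (simp add: quasi_periodic_def cis_cnj cis_mult mult_ac
      flip: mult.assoc[of "cis (t \<bullet> \<omega>)" "cis (- (t \<bullet> \<omega>))"])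
qed

lemma quasi_periodic_partial_deriv:
  assumes "quasi_periodic \<Omega> t \<Psi>"
    and diff: "\<And>x. (\<lambda>s. \<Psi> (x + s *\<^sub>R axis i 1)) differentiable (at 0)"
  shows "quasi_periodic \<Omega> t (partial_deriv i \<Psi>)"
  unfolding quasi_periodic_def
proof (intro allI ballI)
  fix x \<omega> assume \<omega>: "\<omega> \<in> \<Omega>"
  have "((\<lambda>s. \<Psi> (x + s *\<^sub>R axis i 1)) has_vector_derivative partial_deriv i \<Psi> x) (at 0)"
    unfolding partial_deriv_def using diff vector_derivative_works by blast
  then have "((\<lambda>s. cis (t \<bullet> \<omega>) * \<Psi> (x + s *\<^sub>R axis i 1)) has_vector_derivative
      cis (t \<bullet> \<omega>) * partial_deriv i \<Psi> x) (at 0)"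
    by (rule has_vector_derivative_mult_right)
  moreover have "cis (t \<bullet> \<omega>) * \<Psi> (x + s *\<^sub>R axis i 1) = \<Psi> (x + \<omega> + s *\<^sub>R axis i 1)" for s
  proof -
    have "\<Psi> ((x + s *\<^sub>R axis i 1) + \<omega>) = cis (t \<bullet> \<omega>) * \<Psi> (x + s *\<^sub>R axis i 1)"
      using assms(1) \<omega> unfolding quasi_periodic_def by blast
    then show ?thesis by (simp add: add_ac)
  qed
  ultimately show "partial_deriv i \<Psi> (x + \<omega>) = cis (t \<bullet> \<omega>) * partial_deriv i \<Psi> x"
    unfolding partial_deriv_def[of i \<Psi> "x + \<omega>"] by (simp add: vector_derivative_at)
qed

text \<open>Integration by parts, obtained from the product rule: the integral of the derivative of
  \<open>f * cnj (expi (\<gamma> + t))\<close> vanishes.\<close>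

lemma inner_partial_deriv:
  assumes f: "C1 f" and qp: "quasi_periodic \<Omega> t f" and \<gamma>: "\<gamma> \<in> dual_lattice \<Omega>"
  shows "l2_inner F (partial_deriv i f) (expi (\<gamma> + t))
    = \<i> * of_real ((\<gamma> + t) $ i) * l2_inner F f (expi (\<gamma> + t))"
proof -
  define g where "g = \<gamma> + t"
  define D where "D = (\<lambda>x. partial_deriv i f x * cnj (expi g x)
      - f x * (\<i> * of_real (g $ i) * cnj (expi g x)))"
  have cf: "continuous_on UNIV f" and cp: "continuous_on UNIV (partial_deriv i f)"
    and diff: "\<And>x. (\<lambda>s. f (x + s *\<^sub>R axis i 1)) differentiable (at 0)"
    using f by (auto simp: C1_def)
  have "(LINT x|lebesgue_on F. D x) = 0"
  proof (rule integral_derivative_zero[where H = "\<lambda>x. f x * cnj (expi g x)" and e = "axis i 1"])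
    show "continuous_on UNIV (\<lambda>x. f x * cnj (expi g x))" by (intro continuous_intros cf)
    show "continuous_on UNIV D" unfolding D_def by (intro continuous_intros cf cp)
    show "periodic \<Omega> (\<lambda>x. f x * cnj (expi g x))"
      unfolding g_def by (rule quasi_periodic_times_cnj_expi[OF qp \<gamma>])
    fix x
    have d1: "((\<lambda>s. f (x + s *\<^sub>R axis i 1)) has_vector_derivative partial_deriv i f x) (at 0)"
      unfolding partial_deriv_def using diff vector_derivative_works by blast
    have e: "cnj (expi g (x + s *\<^sub>R axis i 1))
        = cnj (expi g x) * exp (- \<i> * of_real (g $ i) * of_real s)" for s
      by (simp add: expi_def inner_add_right inner_axis cis_conv_exp exp_cnj distrib_left
          exp_diff exp_minus field_simps flip: exp_add)
    have "((\<lambda>z. cnj (expi g x) * exp (- \<i> * of_real (g $ i) * z)) has_field_derivative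
        - \<i> * of_real (g $ i) * cnj (expi g x)) (at (of_real 0))"
      by (auto intro!: derivative_eq_intros)
    then have d2: "((\<lambda>s. cnj (expi g (x + s *\<^sub>R axis i 1))) has_vector_derivative
        - \<i> * of_real (g $ i) * cnj (expi g x)) (at 0)"
      unfolding e by (rule has_vector_derivative_real_field)
    show "((\<lambda>s. f (x + s *\<^sub>R axis i 1) * cnj (expi g (x + s *\<^sub>R axis i 1)))
        has_vector_derivative D x) (at 0)"
      using has_vector_derivative_mult[OF d1 d2] by (simp add: D_def algebra_simps)
  qed
  moreover have "(LINT x|lebesgue_on F. D x) = l2_inner F (partial_deriv i f) (expi g)
      - (LINT x|lebesgue_on F. f x * (\<i> * of_real (g $ i) * cnj (expi g x)))"
    unfolding D_def l2_inner_def
    by (intro Bochner_Integration.integral_diff integrable_continuous continuous_intros cf cp)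
  moreover have "(LINT x|lebesgue_on F. f x * (\<i> * of_real (g $ i) * cnj (expi g x)))
      = \<i> * of_real (g $ i) * l2_inner F f (expi g)"
    unfolding l2_inner_def by (simp add: mult_ac flip: integral_mult_right_zero)
  ultimately show ?thesis by (simp add: g_def)
qed

lemma inner_laplacian:
  assumes f: "C2 f" and qp: "quasi_periodic \<Omega> t f" and \<gamma>: "\<gamma> \<in> dual_lattice \<Omega>"
  shows "l2_inner F (\<lambda>x. - laplacian f x) (expi (\<gamma> + t))
    = of_real ((norm (\<gamma> + t))\<^sup>2) * l2_inner F f (expi (\<gamma> + t))"
proof -
  have C1: "C1 f" "\<And>i. C1 (partial_deriv i f)" using f by (auto simp: C2_def)
  have qp1: "quasi_periodic \<Omega> t (partial_deriv i f)" for i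
    using C1(1) by (intro quasi_periodic_partial_deriv qp) (auto simp: C1_def)
  have i2: "\<i> * r * (\<i> * r * z) = - r\<^sup>2 * z" for r z :: complex
  proof -
    have "\<i> * r * (\<i> * r * z) = (\<i> * \<i>) * (r * r) * z" by (simp only: mult_ac)
    then show ?thesis by (simp add: power2_eq_square)
  qed
  have second: "l2_inner F (partial_deriv i (partial_deriv i f)) (expi (\<gamma> + t))
      = - (of_real ((\<gamma> + t) $ i))\<^sup>2 * l2_inner F f (expi (\<gamma> + t))" for i
    unfolding inner_partial_deriv[OF C1(2) qp1 \<gamma>] inner_partial_deriv[OF C1(1) qp \<gamma>]
    by (rule i2)
  have "l2_inner F (laplacian f) (expi (\<gamma> + t))
      = (\<Sum>i\<in>UNIV. l2_inner F (partial_deriv i (partial_deriv i f)) (expi (\<gamma> + t)))"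
    unfolding laplacian_def
  proof (rule l2_sum(2)[OF _ expi_l2])
    show "partial_deriv i (partial_deriv i f) \<in> l2_space F" for i
      using C1(2) by (intro l2_space_continuous) (auto simp: C1_def)
  qed
  also have "\<dots> = - (\<Sum>i\<in>UNIV. (of_real ((\<gamma> + t) $ i))\<^sup>2) * l2_inner F f (expi (\<gamma> + t))"
    unfolding second by (simp only: sum_distrib_right sum_negf mult_minus_left)
  also have "(\<Sum>i\<in>UNIV. (of_real ((\<gamma> + t) $ i))\<^sup>2) = (of_real ((norm (\<gamma> + t))\<^sup>2) :: complex)"
  proof -
    have "(norm (\<gamma> + t))\<^sup>2 = (\<Sum>i\<in>UNIV. ((\<gamma> + t) $ i)\<^sup>2)"
      unfolding power2_norm_eq_inner inner_vec_def by (simp add: power2_eq_square)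
    then show ?thesis by (simp only: of_real_sum of_real_power)
  qed
  finally show ?thesis using l2_inner_scale[of F "-1" "laplacian f"] by simp
qed

end

section \<open>Completeness of the exponentials\<close>

inductive trig_poly :: "(real^'n::finite) set \<Rightarrow> (real^'n \<Rightarrow> complex) \<Rightarrow> bool" for \<Gamma>
  where expi: "\<gamma> \<in> \<Gamma> \<Longrightarrow> trig_poly \<Gamma> (expi \<gamma>)"
  | add: "trig_poly \<Gamma> f \<Longrightarrow> trig_poly \<Gamma> g \<Longrightarrow> trig_poly \<Gamma> (\<lambda>x. f x + g x)"
  | scale: "trig_poly \<Gamma> f \<Longrightarrow> trig_poly \<Gamma> (\<lambda>x. c * f x)"

lemma dual_lattice_add: "\<alpha> \<in> dual_lattice \<Omega> \<Longrightarrow> \<beta> \<in> dual_lattice \<Omega> \<Longrightarrow> \<alpha> + \<beta> \<in> dual_lattice \<Omega>"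
  unfolding dual_lattice_def mem_Collect_eq
  by (metis (no_types, lifting) distrib_left inner_add_left of_int_add)

lemma dual_lattice_minus: "\<alpha> \<in> dual_lattice \<Omega> \<Longrightarrow> - \<alpha> \<in> dual_lattice \<Omega>"
  unfolding dual_lattice_def mem_Collect_eq
  by (metis inner_minus_left mult_minus_right of_int_minus)

lemma dual_lattice_diff: "\<alpha> \<in> dual_lattice \<Omega> \<Longrightarrow> \<beta> \<in> dual_lattice \<Omega> \<Longrightarrow> \<alpha> - \<beta> \<in> dual_lattice \<Omega>"
  using dual_lattice_add[OF _ dual_lattice_minus, of \<alpha> \<Omega> \<beta>] by simp

lemma dual_lattice_zero: "0 \<in> dual_lattice \<Omega>"
  by (auto simp: dual_lattice_def intro: exI[of _ 0])

lemma trig_poly_const: "trig_poly (dual_lattice \<Omega>) (\<lambda>x. c)"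
  using trig_poly.scale[OF trig_poly.expi[OF dual_lattice_zero], of \<Omega> c]
  by (simp add: expi_def)

lemma trig_poly_sum:
  "(\<And>i. i \<in> I \<Longrightarrow> trig_poly (dual_lattice \<Omega>) (f i)) \<Longrightarrow> trig_poly (dual_lattice \<Omega>) (\<lambda>x. \<Sum>i\<in>I. f i x)"
  by (induction I rule: infinite_finite_induct) (auto intro: trig_poly_const trig_poly.add)

lemma trig_poly_mult:
  assumes "trig_poly (dual_lattice \<Omega>) f" "trig_poly (dual_lattice \<Omega>) g"
  shows "trig_poly (dual_lattice \<Omega>) (\<lambda>x. f x * g x)"
  using assms(1)
proof induction
  case (expi \<alpha>)
  show ?case using assms(2)
  proof induction
    case (expi \<beta>)
    then show ?case
      using trig_poly.expi[OF dual_lattice_add[OF \<open>\<alpha> \<in> _\<close> expi]]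
      by (simp add: expi_add_left[abs_def])
  next
    case (add f g)
    then show ?case using trig_poly.add by (simp add: distrib_left)
  next
    case (scale f c)
    then show ?case using trig_poly.scale[OF scale.IH, of c] by (simp add: mult_ac)
  qed
next
  case (add f g)
  then show ?case using trig_poly.add by (simp add: distrib_right)
next
  case (scale f c)
  then show ?case using trig_poly.scale[OF scale.IH, of c] by (simp add: mult_ac)
qed

lemma trig_poly_continuous: "trig_poly \<Gamma> f \<Longrightarrow> continuous_on UNIV f"
  by (induction rule: trig_poly.induct) (auto intro: continuous_intros)

context lattice_cell
begin

text \<open>The period torus as a subset of \<open>complex^'n\<close>: two points have the same image exactly if they
  differ by a period, and polynomials in the coordinates of the image pull back to trigonometric
  polynomials.\<close>

definition torus :: "real^'n \<Rightarrow> complex^'n" where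
  "torus x = (\<chi> i. expi ((2 * pi) *\<^sub>R coord i) x)"

text \<open>A real linear function of \<open>torus x\<close> is a combination of real and imaginary parts of exponentials,
  and these are combinations of the exponentials with frequencies \<open>\<plusminus> 2 \<pi> coord i\<close>.\<close>

lemma trig_poly_torus:
  assumes "real_polynomial_function r"
  shows "trig_poly (dual_lattice \<Omega>) (\<lambda>x. of_real (r (torus x)))"
  using assms
proof induction
  case (linear r)
  then interpret r: bounded_linear r .
  define u where "u = (\<lambda>i x. expi ((2 * pi) *\<^sub>R coord i) x)"
  have u: "trig_poly (dual_lattice \<Omega>) (u i)" for i
    unfolding u_def by (intro trig_poly.expi dual_coord)
  have "trig_poly (dual_lattice \<Omega>) (\<lambda>x. expi (- ((2 * pi) *\<^sub>R coord i)) x)" for i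
    by (intro trig_poly.expi dual_lattice_minus dual_coord)
  then have cu: "trig_poly (dual_lattice \<Omega>) (\<lambda>x. cnj (u i x))" for i
    by (simp add: u_def expi_def cis_cnj)
  have "of_real (r (torus x)) = (\<Sum>i\<in>UNIV. (of_real (r (axis i 1)) / 2) * (u i x + cnj (u i x))
      + (of_real (r (axis i \<i>)) / (2 * \<i>)) * (u i x + (- 1) * cnj (u i x)))" for x
  proof -
    have "torus x = (\<Sum>i\<in>UNIV. Re (u i x) *\<^sub>R axis i 1 + Im (u i x) *\<^sub>R axis i \<i>)"
      by (simp add: vec_eq_iff torus_def u_def axis_def if_distrib if_distribR sum.distrib
          sum.delta complex_eq_iff cong: if_cong)
    then have "r (torus x) = (\<Sum>i\<in>UNIV. Re (u i x) * r (axis i 1) + Im (u i x) * r (axis i \<i>))"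
      by (simp add: r.sum r.add r.scaleR)
    moreover have "of_real (Re (u i x) * r (axis i 1) + Im (u i x) * r (axis i \<i>))
        = (of_real (r (axis i 1)) / 2) * (u i x + cnj (u i x))
      + (of_real (r (axis i \<i>)) / (2 * \<i>)) * (u i x + (- 1) * cnj (u i x))" for i
      by (simp add: complex_eq_iff Re_divide Im_divide)
    ultimately show ?thesis by (simp only: of_real_sum)
  qed
  then show ?case
    by (simp only:) (intro trig_poly_sum trig_poly.add trig_poly.scale u cu)
next
  case (const c)
  then show ?case by (rule trig_poly_const)
next
  case (add f g)
  then show ?case using trig_poly.add by simp
next
  case (mult f g)
  then show ?case using trig_poly_mult by simp
qed

lemma torus_eq_imp_diff_mem:
  assumes "torus x = torus y"
  shows "x - y \<in> \<Omega>"
  unfolding Omega_iff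
proof
  fix i
  have "expi ((2 * pi) *\<^sub>R coord i) x = expi ((2 * pi) *\<^sub>R coord i) y"
    using assms by (simp add: torus_def vec_eq_iff)
  then have "expi ((2 * pi) *\<^sub>R coord i) (x - y) = 1"
    by (simp add: expi_def inner_diff_right right_diff_distrib flip: cis_divide)
  then have "cos (2 * pi * (coord i \<bullet> (x - y))) = 1"
    by (simp add: expi_def complex_eq_iff)
  then obtain k :: int where "2 * pi * (coord i \<bullet> (x - y)) = real_of_int k * 2 * pi"
    unfolding cos_one_2pi_int by blast
  then have "coord i \<bullet> (x - y) = of_int k" by simp
  then show "coord i \<bullet> (x - y) \<in> \<int>" by simp
qed

text \<open>A continuous periodic function factors through the compact torus. The factor is continuous because
  \<^const>\<open>torus\<close> maps compact sets to compact sets, so it sends closed preimages in the closed cell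
  to closed sets. Stone--Weierstrass on the torus then gives the approximation.\<close>

lemma periodic_approximation:
  assumes h: "continuous_on UNIV h" and per: "periodic \<Omega> h" and e: "e > 0"
  shows "\<exists>p. trig_poly (dual_lattice \<Omega>) p \<and> (\<forall>x. cmod (h x - p x) < e)"
proof -
  have ct: "continuous_on S torus" for S
    unfolding torus_def by (intro continuous_on_vec_lambda continuous_intros)
  define K where "K = torus ` closure F"
  have compF: "compact (closure F)" using bounded_F by simp
  then have K: "compact K" unfolding K_def by (intro compact_continuous_image ct)
  have eqh: "h x = h y" if "torus x = torus y" for x y
  proof -
    have "h (y + (x - y)) = h y" using per torus_eq_imp_diff_mem[OF that] unfolding periodic_def by blast
    then show ?thesis by simp
  qed
  define H where "H = (\<lambda>z. h (SOME x. torus x = z))"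
  have H: "H (torus x) = h x" for x
    unfolding H_def by (rule eqh) (metis (mono_tags) someI_ex)
  have inK: "torus x \<in> K" for x
  proof -
    obtain \<omega> where \<omega>: "\<omega> \<in> \<Omega>" "x - \<omega> \<in> F" using exists_cell_shift by blast
    have "expi ((2 * pi) *\<^sub>R coord i) ((x - \<omega>) + \<omega>) = expi ((2 * pi) *\<^sub>R coord i) (x - \<omega>)" for i
      using periodic_expi[OF dual_coord] \<omega> unfolding periodic_def by blast
    then have "torus x = torus (x - \<omega>)" by (simp add: torus_def vec_eq_iff)
    then show ?thesis unfolding K_def using \<omega> closure_subset by blast
  qed
  have "continuous_on K H"
  proof (subst continuous_on_closed_vimage)
    show "closed K" using K by (rule compact_imp_closed)
    show "\<forall>C. closed C \<longrightarrow> closed (H -` C \<inter> K)"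
    proof (intro allI impI)
      fix C :: "complex set" assume "closed C"
      then have "closed (h -` C \<inter> UNIV)"
        using h continuous_on_closed_vimage[of UNIV h] by blast
      then have "compact (closure F \<inter> h -` C)" using compF by (auto intro: compact_Int_closed)
      then have "compact (torus ` (closure F \<inter> h -` C))" by (intro compact_continuous_image ct)
      moreover have "H -` C \<inter> K = torus ` (closure F \<inter> h -` C)"
        by (auto simp: K_def H)
      ultimately show "closed (H -` C \<inter> K)" by (simp add: compact_imp_closed)
    qed
  qed
  from Stone_Weierstrass_polynomial_function[OF K this e]
  obtain g where g: "polynomial_function g" "\<forall>z\<in>K. norm (H z - g z) < e" by blast
  have re: "real_polynomial_function (\<lambda>z. Re (g z))" and im: "real_polynomial_function (\<lambda>z. Im (g z))"
    using g(1) bounded_linear_Re bounded_linear_Im unfolding polynomial_function_def o_def by blast+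
  have "trig_poly (dual_lattice \<Omega>) (\<lambda>x. of_real (Re (g (torus x))) + \<i> * of_real (Im (g (torus x))))"
    by (intro trig_poly.add trig_poly.scale trig_poly_torus[OF re] trig_poly_torus[OF im])
  then have "trig_poly (dual_lattice \<Omega>) (\<lambda>x. g (torus x))"
    by (simp flip: complex_eq)
  moreover have "cmod (h x - g (torus x)) < e" for x
    using g(2) inK[of x] by (auto simp: H)
  ultimately show ?thesis by blast
qed

text \<open>Each \<open>G j\<close> is uniformly close to \<open>e\<^sub>0\<close> times a trigonometric polynomial, to which \<open>f\<close> is
  orthogonal. Hence \<open>(G j, f)\<close> tends to 0, but it also tends to \<open>\<parallel>f\<parallel>\<^sup>2\<close>.\<close>

lemma zero_if_coefficients_zero:
  assumes lim: "l2_tendsto F G f sequentially"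
    and G: "\<And>j. continuous_on UNIV (G j)" "\<And>j. quasi_periodic \<Omega> t (G j)"
    and zero: "\<And>\<gamma>. \<gamma> \<in> dual_lattice \<Omega> \<Longrightarrow> l2_inner F f (expi (\<gamma> + t)) = 0"
  shows "AE x in lebesgue_on F. f x = 0"
proof -
  have f: "f \<in> l2_space F" using lim by (simp add: l2_tendsto_def)
  have orth: "l2_inner F (\<lambda>x. p x * expi t x) f = 0" if "trig_poly (dual_lattice \<Omega>) p" for p
    using that
  proof induction
    case (expi \<gamma>)
    have "l2_inner F (expi (\<gamma> + t)) f = cnj (l2_inner F f (expi (\<gamma> + t)))"
      by (rule l2_inner_commute)
    then show ?case using zero[OF expi] by (simp add: expi_add_left[abs_def])
  next
    case (add p r)
    have "(\<lambda>x. p x * expi t x) \<in> l2_space F" "(\<lambda>x. r x * expi t x) \<in> l2_space F"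
      by (intro l2_space_continuous continuous_intros trig_poly_continuous[OF add(1)]
        trig_poly_continuous[OF add(2)])+
    then show ?case using l2_inner_add[OF _ _ f] add by (simp add: distrib_right)
  next
    case (scale p c)
    then show ?case using l2_inner_scale[of F c "\<lambda>x. p x * expi t x" f] by (simp add: mult.assoc)
  qed
  have small: "cmod (l2_inner F (G j) f) \<le> inverse (Suc j) * l2_norm F f" for j
  proof -
    have "quasi_periodic \<Omega> t (G j) \<Longrightarrow> 0 \<in> dual_lattice \<Omega> \<Longrightarrow> periodic \<Omega> (\<lambda>x. G j x * cnj (expi (0 + t) x))"
      by (rule quasi_periodic_times_cnj_expi)
    then have "periodic \<Omega> (\<lambda>x. G j x * cnj (expi t x))" using G(2)[of j] dual_lattice_zero[of \<Omega>] by simp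
    moreover have "continuous_on UNIV (\<lambda>x. G j x * cnj (expi t x))" by (intro continuous_intros G)
    ultimately obtain p where p: "trig_poly (dual_lattice \<Omega>) p"
      "\<And>x. cmod (G j x * cnj (expi t x) - p x) < inverse (Suc j)"
      using periodic_approximation[of _ "inverse (real (Suc j))"] by (auto simp del: of_nat_Suc)
    define P where "P = (\<lambda>x. p x * expi t x)"
    have P: "P \<in> l2_space F" and Gl: "G j \<in> l2_space F" unfolding P_def
      by (intro l2_space_continuous continuous_intros trig_poly_continuous[OF p(1)] G)+
    have close: "cmod (G j x - P x) \<le> inverse (Suc j)" for x
    proof -
      have "G j x - P x = (G j x * cnj (expi t x) - p x) * expi t x"
        using expi_mult_cnj_self[of t x] by (simp add: P_def left_diff_distrib mult.assoc mult.commute[of "cnj _"])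
      then show ?thesis using p(2)[of x] by (simp add: norm_mult)
    qed
    have "l2_inner F (G j) f = l2_inner F (\<lambda>x. G j x - P x) f"
      using l2_inner_diff[OF Gl P f] orth[OF p(1)] by (simp add: P_def)
    also have "cmod \<dots> \<le> l2_norm F (\<lambda>x. G j x - P x) * l2_norm F f"
      by (intro l2_cauchy_schwarz l2_space_diff Gl P f)
    also have "\<dots> \<le> inverse (Suc j) * l2_norm F f"
      using close by (intro mult_right_mono l2_norm_le_sup l2_space_diff Gl P l2_norm_nonneg)
    finally show ?thesis .
  qed
  have "(\<lambda>j. l2_inner F (G j) f) \<longlonglongrightarrow> 0"
  proof (rule Lim_null_comparison)
    show "(\<lambda>j. inverse (Suc j) * l2_norm F f) \<longlonglongrightarrow> 0"
      using tendsto_mult_left_zero[OF LIMSEQ_inverse_real_of_nat] by simp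
  qed (use small in auto)
  moreover have "(\<lambda>j. l2_inner F (G j) f) \<longlonglongrightarrow> l2_inner F f f" by (rule l2_inner_tendsto[OF lim f])
  ultimately have "l2_inner F f f = 0" by (rule LIMSEQ_unique[symmetric])
  moreover have "l2_inner F f f = of_real (LINT x|lebesgue_on F. (cmod (f x))\<^sup>2)"
    unfolding l2_inner_def by (simp flip: complex_norm_square integral_complex_of_real)
  ultimately have "(LINT x|lebesgue_on F. (cmod (f x))\<^sup>2) = 0" by simp
  then have "AE x in lebesgue_on F. (cmod (f x))\<^sup>2 = 0"
    using integral_nonneg_eq_0_iff_AE[OF l2_spaceD(2)[OF f]] by simp
  then show ?thesis by simp
qed

end

section \<open>Layers of the dual lattice\<close>

locale layered_lattice = lattice_cell w \<Omega> F
  for w :: "'n::finite \<Rightarrow> real^'n" and \<Omega> F :: "(real^'n) set" +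
  fixes v :: "'n \<Rightarrow> real^'n" and k :: 'n and t :: "real^'n" and q :: "real^'n \<Rightarrow> complex"
  assumes dual_basis: "lattice_basis v (dual_lattice \<Omega>)"
    and potential: "q \<in> potentials_plus F v k"
begin

text \<open>The member of the dual basis of \<open>v\<close> that belongs to \<open>v k\<close>.\<close>

definition normal :: "real^'n" where
  "normal = (SOME d. \<forall>i. d \<bullet> v i = (if i = k then 1 else 0))"

definition height :: "real^'n \<Rightarrow> real" where
  "height \<gamma> = normal \<bullet> \<gamma>"

lemma height_basis: "height (v i) = (if i = k then 1 else 0)"
proof -
  obtain d where "\<forall>i j. d i \<bullet> v j = (if i = j then 1 else (0::real))"
    using exists_dual_basis[of v] dual_basis by (auto simp: lattice_basis_def)
  then have "\<forall>i. d k \<bullet> v i = (if i = k then 1 else 0)" by auto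
  then have "\<forall>i. normal \<bullet> v i = (if i = k then 1 else 0)" unfolding normal_def by (rule someI)
  then show ?thesis by (simp add: height_def)
qed

lemma height_linear:
  "height (x + y) = height x + height y" "height (x - y) = height x - height y"
  "height (c *\<^sub>R x) = c * height x" "height 0 = 0"
  by (simp_all add: height_def inner_add_right inner_diff_right)

lemma height_sum: "height (\<Sum>i\<in>I. f i) = (\<Sum>i\<in>I. height (f i))"
  by (simp add: height_def inner_sum_right)

lemma dual_span: "dual_lattice \<Omega> = range (\<lambda>c::'n \<Rightarrow> int. \<Sum>i\<in>UNIV. real_of_int (c i) *\<^sub>R v i)"
  using dual_basis by (simp add: lattice_basis_def int_span_def)

lemma height_span: "height (\<Sum>i\<in>UNIV. real_of_int (c i) *\<^sub>R v i) = real_of_int (c k)"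
  by (simp add: height_sum height_linear height_basis if_distrib sum.delta cong: if_cong)

lemma height_int: "\<gamma> \<in> dual_lattice \<Omega> \<Longrightarrow> \<exists>z::int. height \<gamma> = real_of_int z"
  unfolding dual_span using height_span by auto

lemma v_mem: "real_of_int z *\<^sub>R v k \<in> dual_lattice \<Omega>"
proof -
  have "real_of_int z *\<^sub>R v k = (\<Sum>i\<in>UNIV. if i = k then real_of_int z *\<^sub>R v i else 0)" by simp
  also have "\<dots> = (\<Sum>i\<in>UNIV. real_of_int ((\<lambda>i. if i = k then z else 0) i) *\<^sub>R v i)"
    by (intro sum.cong) auto
  finally show ?thesis unfolding dual_span
    by (rule image_eqI[where f = "\<lambda>c. \<Sum>i\<in>UNIV. real_of_int (c i) *\<^sub>R v i"]) (rule UNIV_I)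
qed

lemma height_v [simp]: "height (r *\<^sub>R v k) = r"
  by (simp add: height_linear height_basis)

lemma sublattice_iff: "u \<in> sublattice v k \<longleftrightarrow> u \<in> dual_lattice \<Omega> \<and> height u = 0"
proof
  assume "u \<in> sublattice v k"
  then obtain c :: "'n \<Rightarrow> int" where c: "u = (\<Sum>i\<in>UNIV - {k}. real_of_int (c i) *\<^sub>R v i)"
    by (auto simp: sublattice_def int_span_def)
  also have "\<dots> = (\<Sum>i\<in>UNIV. real_of_int ((\<lambda>i. if i = k then 0 else c i) i) *\<^sub>R v i)"
    by (intro sum.mono_neutral_cong_left) auto
  finally have u: "u = (\<Sum>i\<in>UNIV. real_of_int ((\<lambda>i. if i = k then 0 else c i) i) *\<^sub>R v i)" .
  then have "u \<in> dual_lattice \<Omega>" unfolding dual_span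
    by (rule image_eqI[where f = "\<lambda>c. \<Sum>i\<in>UNIV. real_of_int (c i) *\<^sub>R v i"]) (rule UNIV_I)
  moreover have "height u = 0" unfolding u height_span by simp
  ultimately show "u \<in> dual_lattice \<Omega> \<and> height u = 0" ..
next
  assume u: "u \<in> dual_lattice \<Omega> \<and> height u = 0"
  then obtain c :: "'n \<Rightarrow> int" where c: "u = (\<Sum>i\<in>UNIV. real_of_int (c i) *\<^sub>R v i)"
    unfolding dual_span by auto
  then have "c k = 0" using u height_span[of c] by simp
  then have "u = (\<Sum>i\<in>UNIV - {k}. real_of_int (c i) *\<^sub>R v i)"
    unfolding c by (intro sum.mono_neutral_right) auto
  then show "u \<in> sublattice v k" unfolding sublattice_def int_span_def
    by (rule image_eqI[where f = "\<lambda>c. \<Sum>i\<in>UNIV - {k}. real_of_int (c i) *\<^sub>R v i"]) (rule UNIV_I)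
qed

lemma layer_decomposition:
  assumes "\<gamma> \<in> dual_lattice \<Omega>" "height \<gamma> = real_of_int z"
  shows "\<gamma> - real_of_int z *\<^sub>R v k \<in> sublattice v k"
  using assms by (simp add: sublattice_iff height_linear height_basis dual_lattice_diff v_mem)

lemma sublattice_layer_iff:
  "\<gamma> \<in> sublattice_layer v k z \<longleftrightarrow> \<gamma> \<in> dual_lattice \<Omega> \<and> height \<gamma> = real_of_int z"
proof
  assume "\<gamma> \<in> sublattice_layer v k z"
  then show "\<gamma> \<in> dual_lattice \<Omega> \<and> height \<gamma> = real_of_int z"
    by (auto simp: sublattice_layer_def sublattice_iff height_linear height_basis
        intro: dual_lattice_add v_mem)
next
  assume \<gamma>: "\<gamma> \<in> dual_lattice \<Omega> \<and> height \<gamma> = real_of_int z"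
  then have "\<gamma> - real_of_int z *\<^sub>R v k \<in> sublattice v k" by (intro layer_decomposition) auto
  then show "\<gamma> \<in> sublattice_layer v k z"
    unfolding sublattice_layer_def by (intro CollectI exI[of _ "\<gamma> - real_of_int z *\<^sub>R v k"]) auto
qed

lemma sublattice_plus_iff: "\<gamma> \<in> sublattice_plus v k \<longleftrightarrow> \<gamma> \<in> dual_lattice \<Omega> \<and> height \<gamma> \<ge> 1"
proof
  assume "\<gamma> \<in> sublattice_plus v k"
  then obtain u m where um: "\<gamma> = u + real m *\<^sub>R v k" "u \<in> sublattice v k" "m \<ge> 1"
    by (auto simp: sublattice_plus_def)
  then show "\<gamma> \<in> dual_lattice \<Omega> \<and> height \<gamma> \<ge> 1"
    using v_mem[of "int m"]
    by (auto simp: sublattice_iff height_linear height_basis intro: dual_lattice_add)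
next
  assume \<gamma>: "\<gamma> \<in> dual_lattice \<Omega> \<and> height \<gamma> \<ge> 1"
  then obtain z :: int where z: "height \<gamma> = real_of_int z" using height_int by blast
  then have "z \<ge> 1" using \<gamma> by linarith
  then obtain m where m: "z = int m" using nonneg_int_cases[of z] by auto
  have "\<gamma> - real m *\<^sub>R v k \<in> sublattice v k"
    using layer_decomposition[of \<gamma> z] \<gamma> z m by simp
  then show "\<gamma> \<in> sublattice_plus v k"
    unfolding sublattice_plus_def using \<open>z \<ge> 1\<close> m
    by (intro CollectI exI[of _ "\<gamma> - real m *\<^sub>R v k"] exI[of _ m]) auto
qed

section \<open>The operator on Fourier coefficients\<close>

text \<open>Fourier coefficients with respect to the shifted exponentials, which satisfy the
  quasi-periodicity conditions.\<close>

definition hat :: "(real^'n \<Rightarrow> complex) \<Rightarrow> real^'n \<Rightarrow> complex" where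
  "hat \<psi> \<gamma> = l2_inner F \<psi> (expi (\<gamma> + t))"

text \<open>The coefficients of \<open>q \<psi>\<close>; \<open>conv_has_sum\<close> below shows that they are the convolution of the
  coefficients of \<open>q\<close> and \<open>\<psi>\<close>.\<close>

definition conv :: "(real^'n \<Rightarrow> complex) \<Rightarrow> real^'n \<Rightarrow> complex" where
  "conv \<psi> \<gamma> = hat (\<lambda>x. q x * \<psi> x) \<gamma>"

lemma q_summable: "(\<lambda>\<beta>. cmod (fourier_coeff F q \<beta>)) summable_on sublattice_plus v k"
  and q_sum: "((\<lambda>\<beta>. fourier_coeff F q \<beta> * expi \<beta> x) has_sum q x) (sublattice_plus v k)"
  using potential by (auto simp: potentials_plus_def)

lemma q_uniform:
  "uniform_limit UNIV (\<lambda>X x. \<Sum>\<beta>\<in>X. fourier_coeff F q \<beta> * expi \<beta> x) q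
     (finite_subsets_at_top (sublattice_plus v k))"
  by (rule Weierstrass_m_test_general'[OF _ q_sum q_summable]) (simp add: norm_mult)

lemma q_continuous: "continuous_on UNIV q"
  by (rule uniform_limit_theorem[OF _ q_uniform]) (auto intro!: always_eventually continuous_intros)

lemma q_bounded: "cmod (q x) \<le> (\<Sum>\<^sub>\<infinity>\<beta>\<in>sublattice_plus v k. cmod (fourier_coeff F q \<beta>))"
proof -
  have "q x = (\<Sum>\<^sub>\<infinity>\<beta>\<in>sublattice_plus v k. fourier_coeff F q \<beta> * expi \<beta> x)"
    using q_sum[of x] by (simp add: infsumI)
  also have "cmod \<dots> \<le> (\<Sum>\<^sub>\<infinity>\<beta>\<in>sublattice_plus v k. cmod (fourier_coeff F q \<beta> * expi \<beta> x))"
    using q_summable by (intro norm_infsum_bound) (simp add: norm_mult)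
  finally show ?thesis by (simp add: norm_mult)
qed

lemma q_mult_l2: "\<psi> \<in> l2_space F \<Longrightarrow> (\<lambda>x. q x * \<psi> x) \<in> l2_space F"
  by (rule l2_space_mult_bounded[OF _ measurable_continuous[OF q_continuous] q_bounded])

text \<open>The partial sums of the Fourier series of \<open>q\<close> converge uniformly, so multiplication of \<open>\<psi>\<close> by
  them converges to multiplication by \<open>q\<close>, while multiplication by \<open>expi \<beta>\<close> shifts coefficients
  by \<open>\<beta>\<close>.\<close>

lemma conv_has_sum:
  assumes \<psi>: "\<psi> \<in> l2_space F"
  shows "((\<lambda>\<beta>. fourier_coeff F q \<beta> * hat \<psi> (\<gamma> - \<beta>)) has_sum conv \<psi> \<gamma>) (sublattice_plus v k)"
  unfolding has_sum_def
proof (rule tendstoI)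
  fix e :: real assume e: "e > 0"
  define S where "S = (\<lambda>X x. \<Sum>\<beta>\<in>X. fourier_coeff F q \<beta> * expi \<beta> x)"
  have contS: "continuous_on UNIV (S X)" for X unfolding S_def by (intro continuous_intros)
  \<comment> \<open>The summand 1 keeps the denominator positive when \<open>\<psi>\<close> is a null function.\<close>
  define \<epsilon> where "\<epsilon> = e / (l2_norm F \<psi> + 1)"
  have \<epsilon>: "\<epsilon> > 0" using e l2_norm_nonneg[of F \<psi>] by (simp add: \<epsilon>_def)
  have "\<forall>\<^sub>F X in finite_subsets_at_top (sublattice_plus v k). \<forall>x\<in>UNIV. dist (S X x) (q x) < \<epsilon>"
    using q_uniform \<epsilon> unfolding uniform_limit_iff S_def by blast
  then show "\<forall>\<^sub>F X in finite_subsets_at_top (sublattice_plus v k).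
      dist (\<Sum>\<beta>\<in>X. fourier_coeff F q \<beta> * hat \<psi> (\<gamma> - \<beta>)) (conv \<psi> \<gamma>) < e"
  proof eventually_elim
    case (elim X)
    define E where "E = (\<lambda>x. cnj (S X x - q x) * expi (\<gamma> + t) x)"
    have cE: "continuous_on UNIV E" unfolding E_def by (intro continuous_intros contS q_continuous)
    have E: "E \<in> l2_space F" by (rule l2_space_continuous[OF cE])
    have summand: "(\<lambda>x. (fourier_coeff F q \<beta> * expi \<beta> x) * \<psi> x) \<in> l2_space F"
        "hat (\<lambda>x. (fourier_coeff F q \<beta> * expi \<beta> x) * \<psi> x) \<gamma>
          = fourier_coeff F q \<beta> * hat \<psi> (\<gamma> - \<beta>)" for \<beta>
    proof -
      show "(\<lambda>x. (fourier_coeff F q \<beta> * expi \<beta> x) * \<psi> x) \<in> l2_space F"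
        by (rule l2_space_mult_bounded[OF \<psi>, where B = "cmod (fourier_coeff F q \<beta>)"])
           (auto intro!: measurable_continuous continuous_intros simp: norm_mult)
      have "expi \<beta> x * cnj (expi (\<gamma> + t) x) = cnj (expi (\<gamma> - \<beta> + t) x)" for x
        by (simp add: expi_diff_left expi_add_left mult_ac)
      then have "(fourier_coeff F q \<beta> * expi \<beta> x) * \<psi> x * cnj (expi (\<gamma> + t) x)
          = fourier_coeff F q \<beta> * (\<psi> x * cnj (expi (\<gamma> - \<beta> + t) x))" for x
        by (metis (no_types, lifting) mult.assoc mult.commute)
      then show "hat (\<lambda>x. (fourier_coeff F q \<beta> * expi \<beta> x) * \<psi> x) \<gamma>
          = fourier_coeff F q \<beta> * hat \<psi> (\<gamma> - \<beta>)"
        by (simp only: hat_def l2_inner_def integral_mult_right_zero)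
    qed
    have SX: "(\<lambda>x. S X x * \<psi> x) \<in> l2_space F"
        "hat (\<lambda>x. S X x * \<psi> x) \<gamma> = (\<Sum>\<beta>\<in>X. fourier_coeff F q \<beta> * hat \<psi> (\<gamma> - \<beta>))"
      using l2_sum[of X "\<lambda>\<beta> x. (fourier_coeff F q \<beta> * expi \<beta> x) * \<psi> x" F "expi (\<gamma> + t)"] summand expi_l2
      by (simp_all add: hat_def S_def sum_distrib_right)
    have "(\<Sum>\<beta>\<in>X. fourier_coeff F q \<beta> * hat \<psi> (\<gamma> - \<beta>)) - conv \<psi> \<gamma>
        = l2_inner F (\<lambda>x. S X x * \<psi> x - q x * \<psi> x) (expi (\<gamma> + t))"
      using SX l2_inner_diff[OF SX(1) q_mult_l2[OF \<psi>] expi_l2, of "\<gamma> + t"] by (simp add: conv_def hat_def)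
    also have "\<dots> = l2_inner F \<psi> E"
      unfolding l2_inner_def E_def by (simp add: algebra_simps)
    also have "cmod \<dots> \<le> l2_norm F \<psi> * l2_norm F E" by (rule l2_cauchy_schwarz[OF \<psi> E])
    also have "\<dots> \<le> l2_norm F \<psi> * \<epsilon>"
    proof (intro mult_left_mono l2_norm_le_sup E l2_norm_nonneg)
      fix x show "cmod (E x) \<le> \<epsilon>"
        using elim by (simp add: E_def norm_mult dist_norm less_imp_le del: complex_cnj_diff)
    qed
    also have "\<dots> < (l2_norm F \<psi> + 1) * \<epsilon>" using \<epsilon> by simp
    also have "\<dots> = e" using l2_norm_nonneg[of F \<psi>] by (simp add: \<epsilon>_def)
    finally show ?case by (simp add: dist_norm)
  qed
qed

text \<open>Triangularity: the potential transports coefficients only to strictly higher layers.\<close>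

lemma conv_eq_0:
  assumes \<psi>: "\<psi> \<in> l2_space F" and \<gamma>: "\<gamma> \<in> dual_lattice \<Omega>"
    and zero: "\<And>\<gamma>'. \<gamma>' \<in> dual_lattice \<Omega> \<Longrightarrow> height \<gamma>' < height \<gamma> \<Longrightarrow> hat \<psi> \<gamma>' = 0"
  shows "conv \<psi> \<gamma> = 0"
proof -
  have "hat \<psi> (\<gamma> - \<beta>) = 0" if "\<beta> \<in> sublattice_plus v k" for \<beta>
    using that \<gamma> by (intro zero) (auto simp: sublattice_plus_iff height_linear dual_lattice_diff)
  then have "((\<lambda>\<beta>. fourier_coeff F q \<beta> * hat \<psi> (\<gamma> - \<beta>)) has_sum 0) (sublattice_plus v k)"
    by (intro has_sum_0) auto
  then show ?thesis using conv_has_sum[OF \<psi>] has_sum_unique by blast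
qed

lemma operator_l2:
  assumes "(\<psi>, g) \<in> schroedinger_op F \<Omega> t q"
  shows "\<psi> \<in> l2_space F" "g \<in> l2_space F"
  using assms by (auto simp: schroedinger_op_def l2_tendsto_def)

lemma laplacian_continuous: "C2 f \<Longrightarrow> continuous_on UNIV (laplacian f)"
  unfolding laplacian_def by (intro continuous_intros) (auto simp: C2_def C1_def)

text \<open>For the smooth functions that approximate \<open>\<psi>\<close> in the graph this is integration by parts. The
  coefficient of \<open>q f\<close> at \<open>\<gamma>\<close> is the inner product of \<open>f\<close> with the fixed function
  \<open>cnj q * e\<^sub>\<gamma>\<close>, so both sides pass to the limit.\<close>

lemma operator_hat:
  assumes op: "(\<psi>, g) \<in> schroedinger_op F \<Omega> t q" and \<gamma>: "\<gamma> \<in> dual_lattice \<Omega>"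
  shows "hat g \<gamma> = of_real ((norm (\<gamma> + t))\<^sup>2) * hat \<psi> \<gamma> + conv \<psi> \<gamma>"
proof -
  obtain \<Psi> where \<Psi>: "\<And>j. C2 (\<Psi> j)" "\<And>j. quasi_periodic \<Omega> t (\<Psi> j)"
    and lim: "l2_tendsto F \<Psi> \<psi> sequentially"
    and limg: "l2_tendsto F (\<lambda>j x. - laplacian (\<Psi> j) x + q x * \<Psi> j x) g sequentially"
    using op unfolding schroedinger_op_def by blast
  define e where "e = expi (\<gamma> + t)"
  have el: "e \<in> l2_space F" unfolding e_def by (rule expi_l2)
  have c\<Psi>: "continuous_on UNIV (\<Psi> j)" for j using \<Psi>(1)[of j] by (simp add: C2_def C1_def)
  define r where "r = (\<lambda>x. cnj (q x) * e x)"
  have r: "r \<in> l2_space F" unfolding r_def e_def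
    by (intro l2_space_continuous continuous_intros q_continuous)
  have adj: "l2_inner F (\<lambda>x. q x * f x) e = l2_inner F f r" for f
    unfolding l2_inner_def r_def by (simp add: mult_ac)
  have eq: "l2_inner F (\<lambda>x. - laplacian (\<Psi> j) x + q x * \<Psi> j x) e
      = of_real ((norm (\<gamma> + t))\<^sup>2) * l2_inner F (\<Psi> j) e + l2_inner F (\<Psi> j) r" for j
  proof -
    have "(\<lambda>x. - laplacian (\<Psi> j) x) \<in> l2_space F"
      by (intro l2_space_continuous continuous_intros laplacian_continuous \<Psi>)
    moreover have "(\<lambda>x. q x * \<Psi> j x) \<in> l2_space F"
      by (intro l2_space_continuous continuous_intros q_continuous c\<Psi>)
    ultimately have "l2_inner F (\<lambda>x. - laplacian (\<Psi> j) x + q x * \<Psi> j x) e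
        = l2_inner F (\<lambda>x. - laplacian (\<Psi> j) x) e + l2_inner F (\<lambda>x. q x * \<Psi> j x) e"
      by (rule l2_inner_add[OF _ _ el])
    then show ?thesis unfolding adj unfolding e_def inner_laplacian[OF \<Psi> \<gamma>] .
  qed
  have "(\<lambda>j. of_real ((norm (\<gamma> + t))\<^sup>2) * l2_inner F (\<Psi> j) e + l2_inner F (\<Psi> j) r)
      \<longlonglongrightarrow> of_real ((norm (\<gamma> + t))\<^sup>2) * l2_inner F \<psi> e + l2_inner F \<psi> r"
    by (intro tendsto_intros l2_inner_tendsto[OF lim] el r)
  moreover have "(\<lambda>j. l2_inner F (\<lambda>x. - laplacian (\<Psi> j) x + q x * \<Psi> j x) e) \<longlonglongrightarrow> l2_inner F g e"
    by (rule l2_inner_tendsto[OF limg el])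
  ultimately have "l2_inner F g e = of_real ((norm (\<gamma> + t))\<^sup>2) * l2_inner F \<psi> e + l2_inner F \<psi> r"
    unfolding eq using LIMSEQ_unique by blast
  then show ?thesis unfolding conv_def hat_def e_def[symmetric] adj .
qed

text \<open>By completeness \<open>g\<close> and \<open>\<mu> \<psi>\<close> agree almost everywhere, and the graph of the operator does not
  distinguish such functions.\<close>

lemma eigenfunction_if_coefficients:
  assumes op: "(\<psi>, g) \<in> schroedinger_op F \<Omega> t q"
    and zero: "\<And>\<gamma>. \<gamma> \<in> dual_lattice \<Omega> \<Longrightarrow> hat g \<gamma> = \<mu> * hat \<psi> \<gamma>"
  shows "(\<psi>, \<lambda>x. \<mu> * \<psi> x) \<in> schroedinger_op F \<Omega> t q"
proof -
  obtain \<Psi> where \<Psi>: "\<And>j. C2 (\<Psi> j)" "\<And>j. quasi_periodic \<Omega> t (\<Psi> j)"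
    and lim: "l2_tendsto F \<Psi> \<psi> sequentially"
    and limg: "l2_tendsto F (\<lambda>j x. - laplacian (\<Psi> j) x + q x * \<Psi> j x) g sequentially"
    using op unfolding schroedinger_op_def by blast
  note l2 = operator_l2[OF op]
  have c\<Psi>: "continuous_on UNIV (\<Psi> j)" for j using \<Psi>(1)[of j] by (simp add: C2_def C1_def)
  have qp_q: "q (x + \<omega>) = q x" if \<omega>: "\<omega> \<in> \<Omega>" for x \<omega>
  proof -
    have "((\<lambda>\<beta>. fourier_coeff F q \<beta> * expi \<beta> (x + \<omega>)) has_sum q x) (sublattice_plus v k)
        \<longleftrightarrow> ((\<lambda>\<beta>. fourier_coeff F q \<beta> * expi \<beta> x) has_sum q x) (sublattice_plus v k)"
      by (rule has_sum_cong) (auto simp: sublattice_plus_iff expi_add_right expi_dual_periodic \<omega>)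
    then show ?thesis using q_sum has_sum_unique by blast
  qed
  have qp1: "quasi_periodic \<Omega> t (partial_deriv i f)" if "C1 f" "quasi_periodic \<Omega> t f" for i f
    using that by (intro quasi_periodic_partial_deriv) (auto simp: C1_def)
  have qp2: "quasi_periodic \<Omega> t (laplacian (\<Psi> j))" for j
  proof -
    have "quasi_periodic \<Omega> t (partial_deriv i (partial_deriv i (\<Psi> j)))" for i
      using \<Psi>(1)[of j] \<Psi>(2)[of j] by (auto intro!: qp1 simp: C2_def)
    then show ?thesis unfolding quasi_periodic_def laplacian_def by (simp add: sum_distrib_left)
  qed
  have "AE x in lebesgue_on F. g x - \<mu> * \<psi> x = 0"
  proof (rule zero_if_coefficients_zero)
    show "l2_tendsto F (\<lambda>j x. (- laplacian (\<Psi> j) x + q x * \<Psi> j x) - \<mu> * \<Psi> j x)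
        (\<lambda>x. g x - \<mu> * \<psi> x) sequentially"
      by (rule l2_tendsto_diff_scale[OF limg lim])
    show "continuous_on UNIV (\<lambda>x. (- laplacian (\<Psi> j) x + q x * \<Psi> j x) - \<mu> * \<Psi> j x)" for j
      by (intro continuous_intros laplacian_continuous \<Psi> q_continuous c\<Psi>)
    show "quasi_periodic \<Omega> t (\<lambda>x. (- laplacian (\<Psi> j) x + q x * \<Psi> j x) - \<mu> * \<Psi> j x)" for j
      using qp2[of j] \<Psi>(2)[of j] unfolding quasi_periodic_def
      by (simp add: qp_q right_diff_distrib distrib_left mult.left_commute)
    show "l2_inner F (\<lambda>x. g x - \<mu> * \<psi> x) (expi (\<gamma> + t)) = 0" if "\<gamma> \<in> dual_lattice \<Omega>" for \<gamma>
      using l2_inner_diff[OF l2(2) l2_space_scale[OF l2(1)] expi_l2, of \<mu> "\<gamma> + t"] zero[OF that]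
      by (simp add: hat_def l2_inner_scale)
  qed
  then have "l2_tendsto F (\<lambda>j x. - laplacian (\<Psi> j) x + q x * \<Psi> j x) (\<lambda>x. \<mu> * \<psi> x) sequentially"
    using l2(1) by (intro l2_tendsto_cong_limit[OF limg] l2_space_scale) auto
  then show ?thesis using \<Psi> lim unfolding schroedinger_op_def by blast
qed

section \<open>Triangularity and the obstruction on the upper layer\<close>

lemma shifted_hat:
  assumes "(f, f') \<in> shifted_op (schroedinger_op F \<Omega> t q) \<mu>" and \<gamma>: "\<gamma> \<in> dual_lattice \<Omega>"
  shows "f \<in> l2_space F"
    and "hat f' \<gamma> = (of_real ((norm (\<gamma> + t))\<^sup>2) - \<mu>) * hat f \<gamma> + conv f \<gamma>"
proof -
  obtain g where g: "(f, g) \<in> schroedinger_op F \<Omega> t q" "f' = (\<lambda>x. g x - \<mu> * f x)"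
    using assms(1) by (auto simp: shifted_op_def)
  note l2 = operator_l2[OF g(1)]
  show "f \<in> l2_space F" by (rule l2)
  have "hat f' \<gamma> = hat g \<gamma> - \<mu> * hat f \<gamma>"
    unfolding g(2) hat_def
    using l2_inner_diff[OF l2(2) l2_space_scale[OF l2(1)] expi_l2] by (simp add: l2_inner_scale)
  then show "hat f' \<gamma> = (of_real ((norm (\<gamma> + t))\<^sup>2) - \<mu>) * hat f \<gamma> + conv f \<gamma>"
    unfolding operator_hat[OF g(1) \<gamma>] by (simp add: left_diff_distrib)
qed

text \<open>Below the layer of \<open>\<gamma>\<close> the coefficients stay zero under every application of the operator, so on
  that layer each application of \<open>L - \<mu>\<close> is multiplication by the diagonal entry.\<close>

lemma lowest_layer_resonant:
  assumes "(f, \<lambda>x. 0) \<in> shifted_op (schroedinger_op F \<Omega> t q) \<mu> ^^ s"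
    and \<gamma>: "\<gamma> \<in> dual_lattice \<Omega>"
    and "\<And>\<gamma>'. \<gamma>' \<in> dual_lattice \<Omega> \<Longrightarrow> height \<gamma>' < height \<gamma> \<Longrightarrow> hat f \<gamma>' = 0"
  shows "(of_real ((norm (\<gamma> + t))\<^sup>2) - \<mu>) ^ s * hat f \<gamma> = 0"
  using assms(1,3)
proof (induction s arbitrary: f)
  case 0
  then show ?case by (auto simp: hat_def l2_inner_def)
next
  case (Suc s)
  obtain f' where f': "(f, f') \<in> shifted_op (schroedinger_op F \<Omega> t q) \<mu>"
    "(f', \<lambda>x. 0) \<in> shifted_op (schroedinger_op F \<Omega> t q) \<mu> ^^ s"
    using Suc.prems(1) by (meson relpow_Suc_D2)
  note hat' = shifted_hat(2)[OF f'(1)] and l2 = shifted_hat(1)[OF f'(1) \<gamma>]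
  have "hat f' \<gamma>' = 0" if "\<gamma>' \<in> dual_lattice \<Omega>" "height \<gamma>' < height \<gamma>" for \<gamma>'
  proof -
    have "conv f \<gamma>' = 0" using that by (intro conv_eq_0 l2 Suc.prems(2)) auto
    then show ?thesis using hat'[OF that(1)] Suc.prems(2)[OF that] by simp
  qed
  then have "(of_real ((norm (\<gamma> + t))\<^sup>2) - \<mu>) ^ s * hat f' \<gamma> = 0"
    by (rule Suc.IH[OF f'(2)])
  moreover have "hat f' \<gamma> = (of_real ((norm (\<gamma> + t))\<^sup>2) - \<mu>) * hat f \<gamma>"
    using hat'[OF \<gamma>] conv_eq_0[OF l2 \<gamma> Suc.prems(2)] by simp
  ultimately show ?case by (simp only: power_Suc mult_ac)
qed

text \<open>Grouping the convolution by the height \<open>h\<close> of the frequency leaves the layers \<open>1 \<le> h \<le> r - N\<close>.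
  The last of them meets the lowest layer of \<open>\<psi>\<close>, which has a single coefficient, and contributes
  the isolated term.\<close>

lemma conv_layers:
  assumes \<psi>: "\<psi> \<in> l2_space F" and \<delta>: "\<delta> \<in> sublattice v k"
    and low: "\<And>\<gamma>. \<gamma> \<in> dual_lattice \<Omega> \<Longrightarrow> height \<gamma> \<le> real_of_int N \<Longrightarrow>
      hat \<psi> \<gamma> = (if \<gamma> = \<delta> + real_of_int N *\<^sub>R v k then 1 else 0)"
    and u: "u \<in> sublattice v k" and r: "N < r"
  shows "conv \<psi> (u + real_of_int r *\<^sub>R v k) =
    fourier_coeff F q (u - \<delta> + real_of_int (r - N) *\<^sub>R v k) +
    (\<Sum>h\<in>{1..r - N - 1}. \<Sum>\<^sub>\<infinity>u'\<in>sublattice v k.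
       hat \<psi> (u - u' + real_of_int (r - h) *\<^sub>R v k) * fourier_coeff F q (u' + real_of_int h *\<^sub>R v k))"
proof -
  define \<gamma> where "\<gamma> = u + real_of_int r *\<^sub>R v k"
  define G where "G = (\<lambda>\<beta>. fourier_coeff F q \<beta> * hat \<psi> (\<gamma> - \<beta>))"
  define L where "L = (\<lambda>h::int. (\<lambda>u'. u' + real_of_int h *\<^sub>R v k) ` sublattice v k)"
  have \<gamma>: "\<gamma> \<in> dual_lattice \<Omega>" "height \<gamma> = real_of_int r"
    using u by (auto simp: \<gamma>_def sublattice_iff height_linear height_basis intro: dual_lattice_add v_mem)
  have L: "\<beta> \<in> L h \<longleftrightarrow> \<beta> \<in> dual_lattice \<Omega> \<and> height \<beta> = real_of_int h" for \<beta> h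
  proof -
    have "L h = sublattice_layer v k h" by (auto simp: L_def sublattice_layer_def add.commute)
    then show ?thesis by (simp add: sublattice_layer_iff)
  qed
  have Lsub: "L h \<subseteq> sublattice_plus v k" if "h \<ge> 1" for h
    using that by (auto simp: L sublattice_plus_iff)
  have Lunion: "(\<Union>h\<in>{1..r - N}. L h) \<subseteq> sublattice_plus v k"
    by (rule UN_least) (rule Lsub, simp)
  have sumG: "(G has_sum conv \<psi> \<gamma>) (sublattice_plus v k)"
    unfolding G_def by (rule conv_has_sum[OF \<psi>])
  have sumL: "G summable_on L h" if "h \<ge> 1" for h
    using sumG Lsub[OF that] summable_on_def summable_on_subset_banach by blast
  have "conv \<psi> \<gamma> = infsum G (sublattice_plus v k)" using sumG by (simp add: infsumI)
  also have "\<dots> = infsum G (\<Union>h\<in>{1..r - N}. L h)"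
  proof (rule infsum_cong_neutral)
    fix \<beta> assume \<beta>: "\<beta> \<in> sublattice_plus v k - (\<Union>h\<in>{1..r - N}. L h)"
    then have b: "\<beta> \<in> dual_lattice \<Omega>" "height \<beta> \<ge> 1" by (auto simp: sublattice_plus_iff)
    obtain z :: int where z: "height \<beta> = real_of_int z" using height_int[OF b(1)] by blast
    have "\<beta> \<in> L z" using b z by (simp add: L)
    then have "z > r - N" using \<beta> b z by (cases "z \<le> r - N") auto
    then have lt: "height (\<gamma> - \<beta>) < real_of_int N" using z \<gamma> by (simp add: height_linear)
    moreover have "height (\<delta> + real_of_int N *\<^sub>R v k) = real_of_int N"
      using \<delta> by (simp add: sublattice_iff height_linear height_basis)
    ultimately have "\<gamma> - \<beta> \<noteq> \<delta> + real_of_int N *\<^sub>R v k" by auto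
    then have "hat \<psi> (\<gamma> - \<beta>) = 0" using low[of "\<gamma> - \<beta>"] lt \<gamma> b by (simp add: dual_lattice_diff)
    then show "G \<beta> = 0" by (simp add: G_def)
  qed (use Lunion in blast)+
  also have "\<dots> = (\<Sum>h\<in>{1..r - N}. infsum G (L h))"
    by (rule sum_infsum[symmetric]) (use sumL in \<open>auto simp: L\<close>)
  also have "\<dots> = (\<Sum>h\<in>{1..r - N}. \<Sum>\<^sub>\<infinity>u'\<in>sublattice v k.
       hat \<psi> (u - u' + real_of_int (r - h) *\<^sub>R v k) * fourier_coeff F q (u' + real_of_int h *\<^sub>R v k))"
  proof (rule sum.cong[OF refl])
    fix h
    have "infsum G (L h) = infsum (G \<circ> (\<lambda>u'. u' + real_of_int h *\<^sub>R v k)) (sublattice v k)"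
      unfolding L_def by (rule infsum_reindex) (auto intro: inj_onI)
    also have "\<dots> = (\<Sum>\<^sub>\<infinity>u'\<in>sublattice v k. hat \<psi> (u - u' + real_of_int (r - h) *\<^sub>R v k)
        * fourier_coeff F q (u' + real_of_int h *\<^sub>R v k))"
    proof (rule infsum_cong)
      fix u'
      have "\<gamma> - (u' + real_of_int h *\<^sub>R v k) = u - u' + real_of_int (r - h) *\<^sub>R v k"
        by (simp add: \<gamma>_def scaleR_left_diff_distrib)
      then show "(G \<circ> (\<lambda>u'. u' + real_of_int h *\<^sub>R v k)) u' = hat \<psi> (u - u' + real_of_int (r - h) *\<^sub>R v k)
        * fourier_coeff F q (u' + real_of_int h *\<^sub>R v k)"
        by (simp only: o_def G_def mult.commute)
    qed
    finally show "infsum G (L h) = (\<Sum>\<^sub>\<infinity>u'\<in>sublattice v k. hat \<psi> (u - u' + real_of_int (r - h) *\<^sub>R v k)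
        * fourier_coeff F q (u' + real_of_int h *\<^sub>R v k))" .
  qed
  also have "{1..r - N} = insert (r - N) {1..r - N - 1}" using r by auto
  also have "(\<Sum>h\<in>insert (r - N) {1..r - N - 1}. \<Sum>\<^sub>\<infinity>u'\<in>sublattice v k.
       hat \<psi> (u - u' + real_of_int (r - h) *\<^sub>R v k) * fourier_coeff F q (u' + real_of_int h *\<^sub>R v k))
    = (\<Sum>\<^sub>\<infinity>u'\<in>sublattice v k. hat \<psi> (u - u' + real_of_int N *\<^sub>R v k)
         * fourier_coeff F q (u' + real_of_int (r - N) *\<^sub>R v k))
      + (\<Sum>h\<in>{1..r - N - 1}. \<Sum>\<^sub>\<infinity>u'\<in>sublattice v k.
       hat \<psi> (u - u' + real_of_int (r - h) *\<^sub>R v k) * fourier_coeff F q (u' + real_of_int h *\<^sub>R v k))"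
    by (subst sum.insert) auto
  also have "(\<Sum>\<^sub>\<infinity>u'\<in>sublattice v k. hat \<psi> (u - u' + real_of_int N *\<^sub>R v k)
         * fourier_coeff F q (u' + real_of_int (r - N) *\<^sub>R v k))
      = (\<Sum>\<^sub>\<infinity>u'\<in>{u - \<delta>}. fourier_coeff F q (u' + real_of_int (r - N) *\<^sub>R v k))"
  proof (rule infsum_cong_neutral)
    have hN: "hat \<psi> (u - u' + real_of_int N *\<^sub>R v k) = (if u' = u - \<delta> then 1 else 0)"
      if u': "u' \<in> sublattice v k" for u'
    proof -
      have "u - u' + real_of_int N *\<^sub>R v k \<in> dual_lattice \<Omega>"
        "height (u - u' + real_of_int N *\<^sub>R v k) = real_of_int N"
        using u u' by (auto simp: sublattice_iff height_linear height_basis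
            intro: dual_lattice_add dual_lattice_diff v_mem)
      then show ?thesis using low by (auto simp: algebra_simps)
    qed
    have mem: "u - \<delta> \<in> sublattice v k"
      using u \<delta> by (simp add: sublattice_iff height_linear dual_lattice_diff)
    show "hat \<psi> (u - u' + real_of_int N *\<^sub>R v k) * fourier_coeff F q (u' + real_of_int (r - N) *\<^sub>R v k) = 0"
      if "u' \<in> sublattice v k - {u - \<delta>}" for u'
      using that hN by simp
    show "hat \<psi> (u - u' + real_of_int N *\<^sub>R v k) * fourier_coeff F q (u' + real_of_int (r - N) *\<^sub>R v k)
        = fourier_coeff F q (u' + real_of_int (r - N) *\<^sub>R v k)"
      if "u' \<in> sublattice v k \<inter> {u - \<delta>}" for u'
      using that hN[of u'] by auto
    show "fourier_coeff F q (u' + real_of_int (r - N) *\<^sub>R v k) = 0"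
      if "u' \<in> {u - \<delta>} - sublattice v k" for u'
      using that mem by simp
  qed
  finally show ?thesis by (simp add: \<gamma>_def)
qed

text \<open>Induction over the layers between \<open>N\<close> and \<open>M\<close>: on each of them the coefficients of \<open>\<psi>\<close> and the
  numbers \<open>c\<close> satisfy the same equation, whose right-hand side depends on lower layers only and
  whose factor on the left is not zero. The recursive expression at layer \<open>M\<close> is then the
  convolution.\<close>

lemma conv_eq_recursion:
  assumes \<psi>: "\<psi> \<in> l2_space F" and \<delta>: "\<delta> \<in> sublattice v k"
    and low: "\<And>\<gamma>. \<gamma> \<in> dual_lattice \<Omega> \<Longrightarrow> height \<gamma> \<le> real_of_int N \<Longrightarrow>
      hat \<psi> \<gamma> = (if \<gamma> = \<delta> + real_of_int N *\<^sub>R v k then 1 else 0)"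
    and nonres: "\<And>\<gamma>. \<gamma> \<in> dual_lattice \<Omega> \<Longrightarrow> real_of_int N < height \<gamma> \<Longrightarrow> height \<gamma> < real_of_int M \<Longrightarrow>
      (norm (\<gamma> + t))\<^sup>2 \<noteq> lam"
    and eqn: "\<And>\<gamma>. \<gamma> \<in> dual_lattice \<Omega> \<Longrightarrow> real_of_int N < height \<gamma> \<Longrightarrow> height \<gamma> < real_of_int M \<Longrightarrow>
      of_real (lam - (norm (\<gamma> + t))\<^sup>2) * hat \<psi> \<gamma> = conv \<psi> \<gamma>"
    and c: "\<forall>u\<in>sublattice v k. \<forall>r\<in>{N + 1..M - 1}.
      of_real (lam - (norm (u + real_of_int r *\<^sub>R v k + t))\<^sup>2) * c u r =
      fourier_coeff F q (u - \<delta> + real_of_int (r - N) *\<^sub>R v k) +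
      (\<Sum>h\<in>{1..r - N - 1}. \<Sum>\<^sub>\<infinity>u'\<in>sublattice v k.
         c (u - u') (r - h) * fourier_coeff F q (u' + real_of_int h *\<^sub>R v k))"
    and u: "u \<in> sublattice v k" and NM: "N < M"
  shows "conv \<psi> (u + real_of_int M *\<^sub>R v k) =
      fourier_coeff F q (u - \<delta> + real_of_int (M - N) *\<^sub>R v k) +
      (\<Sum>h\<in>{1..M - N - 1}. \<Sum>\<^sub>\<infinity>u'\<in>sublattice v k.
         c (u - u') (M - h) * fourier_coeff F q (u' + real_of_int h *\<^sub>R v k))"
proof -
  have diff: "u - u' \<in> sublattice v k" if "u \<in> sublattice v k" "u' \<in> sublattice v k" for u u'
    using that by (simp add: sublattice_iff height_linear dual_lattice_diff)
  have rewrite: "conv \<psi> (u + real_of_int r *\<^sub>R v k) =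
      fourier_coeff F q (u - \<delta> + real_of_int (r - N) *\<^sub>R v k) +
      (\<Sum>h\<in>{1..r - N - 1}. \<Sum>\<^sub>\<infinity>u'\<in>sublattice v k.
         c (u - u') (r - h) * fourier_coeff F q (u' + real_of_int h *\<^sub>R v k))"
    if u: "u \<in> sublattice v k" and r: "N < r"
      and known: "\<And>u r'. u \<in> sublattice v k \<Longrightarrow> r' \<in> {N + 1..r - 1} \<Longrightarrow>
        hat \<psi> (u + real_of_int r' *\<^sub>R v k) = c u r'" for u r
  proof -
    have "conv \<psi> (u + real_of_int r *\<^sub>R v k) =
      fourier_coeff F q (u - \<delta> + real_of_int (r - N) *\<^sub>R v k) +
      (\<Sum>h\<in>{1..r - N - 1}. \<Sum>\<^sub>\<infinity>u'\<in>sublattice v k.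
         hat \<psi> (u - u' + real_of_int (r - h) *\<^sub>R v k) * fourier_coeff F q (u' + real_of_int h *\<^sub>R v k))"
      by (rule conv_layers[OF \<psi> \<delta> low u r])
    also have "(\<Sum>h\<in>{1..r - N - 1}. \<Sum>\<^sub>\<infinity>u'\<in>sublattice v k.
         hat \<psi> (u - u' + real_of_int (r - h) *\<^sub>R v k) * fourier_coeff F q (u' + real_of_int h *\<^sub>R v k))
      = (\<Sum>h\<in>{1..r - N - 1}. \<Sum>\<^sub>\<infinity>u'\<in>sublattice v k.
         c (u - u') (r - h) * fourier_coeff F q (u' + real_of_int h *\<^sub>R v k))"
    proof (intro sum.cong infsum_cong refl)
      fix h u' assume "h \<in> {1..r - N - 1}" "u' \<in> sublattice v k"
      then show "hat \<psi> (u - u' + real_of_int (r - h) *\<^sub>R v k) * fourier_coeff F q (u' + real_of_int h *\<^sub>R v k)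
          = c (u - u') (r - h) * fourier_coeff F q (u' + real_of_int h *\<^sub>R v k)"
        using known[OF diff[OF u], of u' "r - h"] by auto
    qed
    finally show ?thesis .
  qed
  have main: "\<forall>u\<in>sublattice v k. hat \<psi> (u + real_of_int r *\<^sub>R v k) = c u r" if "r \<in> {N + 1..M - 1}" for r
    using that
  proof (induction "nat (r - N)" arbitrary: r rule: less_induct)
    case less
    show ?case
    proof
      fix u assume u: "u \<in> sublattice v k"
      define \<gamma> where "\<gamma> = u + real_of_int r *\<^sub>R v k"
      have \<gamma>: "\<gamma> \<in> dual_lattice \<Omega>" "height \<gamma> = real_of_int r"
        using u by (auto simp: \<gamma>_def sublattice_iff height_linear height_basis intro: dual_lattice_add v_mem)
      have rr: "real_of_int N < height \<gamma>" "height \<gamma> < real_of_int M" using less.prems \<gamma> by auto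
      have "of_real (lam - (norm (\<gamma> + t))\<^sup>2) * hat \<psi> \<gamma> = conv \<psi> \<gamma>"
        by (rule eqn[OF \<gamma>(1) rr])
      also have "\<dots> = of_real (lam - (norm (\<gamma> + t))\<^sup>2) * c u r"
        unfolding \<gamma>_def bspec[OF bspec[OF c u] less.prems]
        by (rule rewrite[OF u]) (use less in auto)
      finally have "of_real (lam - (norm (\<gamma> + t))\<^sup>2) * hat \<psi> \<gamma>
        = of_real (lam - (norm (\<gamma> + t))\<^sup>2) * c u r" .
      moreover have "complex_of_real (lam - (norm (\<gamma> + t))\<^sup>2) \<noteq> 0"
        using nonres[OF \<gamma>(1) rr] by (simp del: of_real_diff)
      ultimately show "hat \<psi> (u + real_of_int r *\<^sub>R v k) = c u r"
        unfolding \<gamma>_def by (simp only: mult_cancel_left) simp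
    qed
  qed
  show ?thesis
    by (rule rewrite[OF u NM]) (use main in auto)
qed

text \<open>The equivalence for two layers \<open>N < M\<close>, where above \<open>N\<close> resonances occur on layer \<open>M\<close> only.
  In the application these are the layers \<open>n 2\<close> and \<open>n 1\<close>.\<close>

lemma eigenfunction_iff_obstruction_vanishes:
  assumes root: "root_function F (schroedinger_op F \<Omega> t q) (of_real lam) \<phi>"
    and \<delta>: "\<delta> \<in> sublattice v k" and res_\<delta>: "(norm (\<delta> + real_of_int N *\<^sub>R v k + t))\<^sup>2 = lam"
    and low: "\<And>\<gamma>. \<gamma> \<in> dual_lattice \<Omega> \<Longrightarrow> height \<gamma> \<le> real_of_int N \<Longrightarrow>
      hat \<phi> \<gamma> = (if \<gamma> = \<delta> + real_of_int N *\<^sub>R v k then 1 else 0)"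
    and NM: "N < M"
    and res: "\<And>\<gamma>. \<gamma> \<in> dual_lattice \<Omega> \<Longrightarrow> (norm (\<gamma> + t))\<^sup>2 = lam \<Longrightarrow> real_of_int N < height \<gamma> \<Longrightarrow>
      height \<gamma> = real_of_int M"
    and c: "\<forall>u\<in>sublattice v k. \<forall>r\<in>{N + 1..M - 1}.
      of_real (lam - (norm (u + real_of_int r *\<^sub>R v k + t))\<^sup>2) * c u r =
      fourier_coeff F q (u - \<delta> + real_of_int (r - N) *\<^sub>R v k) +
      (\<Sum>h\<in>{1..r - N - 1}. \<Sum>\<^sub>\<infinity>u'\<in>sublattice v k.
         c (u - u') (r - h) * fourier_coeff F q (u' + real_of_int h *\<^sub>R v k))"
  shows "(\<exists>\<mu>. eigenfunction F (schroedinger_op F \<Omega> t q) \<mu> \<phi>) \<longleftrightarrow>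
    (\<forall>u\<in>sublattice v k. (norm (u + real_of_int M *\<^sub>R v k + t))\<^sup>2 = lam \<longrightarrow>
      fourier_coeff F q (u - \<delta> + real_of_int (M - N) *\<^sub>R v k) +
      (\<Sum>h\<in>{1..M - N - 1}. \<Sum>\<^sub>\<infinity>u'\<in>sublattice v k.
         c (u - u') (M - h) * fourier_coeff F q (u' + real_of_int h *\<^sub>R v k)) = 0)"
    (is "?eigen \<longleftrightarrow> ?obstruction")
proof -
  define \<gamma>0 where "\<gamma>0 = \<delta> + real_of_int N *\<^sub>R v k"
  have \<gamma>0: "\<gamma>0 \<in> dual_lattice \<Omega>" "height \<gamma>0 = real_of_int N"
    using \<delta> by (auto simp: \<gamma>0_def sublattice_iff height_linear height_basis intro: dual_lattice_add v_mem)
  have nonres: "(norm (\<gamma> + t))\<^sup>2 \<noteq> lam"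
    if "\<gamma> \<in> dual_lattice \<Omega>" "real_of_int N < height \<gamma>" "height \<gamma> < real_of_int M" for \<gamma>
    using that res[of \<gamma>] by auto
  obtain s where s: "s \<ge> 1" "(\<phi>, \<lambda>x. 0) \<in> shifted_op (schroedinger_op F \<Omega> t q) (of_real lam) ^^ s"
    and nonzero: "\<not> (AE x in lebesgue_on F. \<phi> x = 0)"
    using root by (auto simp: root_function_def)
  obtain s' where s': "s = Suc s'" using s(1) by (cases s) auto
  obtain g where g: "(\<phi>, g) \<in> shifted_op (schroedinger_op F \<Omega> t q) (of_real lam)"
    "(g, \<lambda>x. 0) \<in> shifted_op (schroedinger_op F \<Omega> t q) (of_real lam) ^^ s'"
    using s(2) unfolding s' by (meson relpow_Suc_D2)
  have \<phi>: "\<phi> \<in> l2_space F" by (rule shifted_hat(1)[OF g(1) \<gamma>0(1)])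
  have conv_low: "conv \<phi> \<gamma> = 0" if "\<gamma> \<in> dual_lattice \<Omega>" "height \<gamma> \<le> real_of_int N" for \<gamma>
  proof (rule conv_eq_0[OF \<phi> that(1)])
    fix \<gamma>' assume "\<gamma>' \<in> dual_lattice \<Omega>" "height \<gamma>' < height \<gamma>"
    then show "hat \<phi> \<gamma>' = 0" using low[of \<gamma>'] that \<gamma>0 by (auto simp flip: \<gamma>0_def)
  qed
  show ?thesis
  proof
    assume ?eigen
    then obtain \<mu> where \<mu>: "(\<phi>, \<lambda>x. \<mu> * \<phi> x) \<in> schroedinger_op F \<Omega> t q"
      by (auto simp: eigenfunction_def)
    have h: "\<mu> * hat \<phi> \<gamma> = of_real ((norm (\<gamma> + t))\<^sup>2) * hat \<phi> \<gamma> + conv \<phi> \<gamma>"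
      if "\<gamma> \<in> dual_lattice \<Omega>" for \<gamma>
      using operator_hat[OF \<mu> that] by (simp add: hat_def l2_inner_scale)
    have "hat \<phi> \<gamma>0 = 1" using low[OF \<gamma>0(1)] \<gamma>0 by (simp add: \<gamma>0_def)
    then have \<mu>lam: "\<mu> = of_real lam"
      using h[OF \<gamma>0(1)] conv_low[OF \<gamma>0(1)] \<gamma>0(2) res_\<delta> by (simp add: \<gamma>0_def)
    have eqn: "of_real (lam - (norm (\<gamma> + t))\<^sup>2) * hat \<phi> \<gamma> = conv \<phi> \<gamma>" if "\<gamma> \<in> dual_lattice \<Omega>" for \<gamma>
      using h[OF that] unfolding \<mu>lam by (simp add: left_diff_distrib)
    show ?obstruction
    proof (intro ballI impI)
      fix u assume u: "u \<in> sublattice v k" and ures: "(norm (u + real_of_int M *\<^sub>R v k + t))\<^sup>2 = lam"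
      have "u + real_of_int M *\<^sub>R v k \<in> dual_lattice \<Omega>"
        using u by (auto simp: sublattice_iff intro: dual_lattice_add v_mem)
      then have "conv \<phi> (u + real_of_int M *\<^sub>R v k) = 0" using eqn ures by force
      then show "fourier_coeff F q (u - \<delta> + real_of_int (M - N) *\<^sub>R v k) +
      (\<Sum>h\<in>{1..M - N - 1}. \<Sum>\<^sub>\<infinity>u'\<in>sublattice v k.
         c (u - u') (M - h) * fourier_coeff F q (u' + real_of_int h *\<^sub>R v k)) = 0"
        using conv_eq_recursion[OF \<phi> \<delta> low nonres eqn c u NM] by simp
    qed
  next
    assume obstruction: ?obstruction
    note hg = shifted_hat(2)[OF g(1)]
    \<comment> \<open>Strong induction on the distance from layer \<open>N\<close>; all layers up to \<open>N\<close> are base cases.\<close>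
    have below: "hat g \<gamma> = 0" if "\<gamma> \<in> dual_lattice \<Omega>" "height \<gamma> = real_of_int z" for \<gamma> z
      using that
    proof (induction "nat (z - N)" arbitrary: \<gamma> z rule: less_induct)
      case less
      have IH: "hat g \<gamma>' = 0" if lt: "height \<gamma>' < real_of_int z" and \<gamma>': "\<gamma>' \<in> dual_lattice \<Omega>"
        and zN: "z > N" for \<gamma>'
      proof -
        obtain z' :: int where z': "height \<gamma>' = real_of_int z'" using height_int[OF \<gamma>'] by blast
        then have "nat (z' - N) < nat (z - N)" using lt zN by simp
        then show ?thesis using less.hyps \<gamma>' z' by blast
      qed
      show ?case
      proof (cases "z \<le> N")
        case True
        have "conv \<phi> \<gamma> = 0" using True less.prems by (intro conv_low) auto
        then show ?thesis
          using hg[OF less.prems(1)] low[OF less.prems(1)] less.prems(2) True res_\<delta> by auto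
      next
        case False
        \<comment> \<open>At a resonance the coefficient of \<open>g\<close> is the obstruction; elsewhere triangularity excludes it.\<close>
        show ?thesis
        proof (cases "(norm (\<gamma> + t))\<^sup>2 = lam")
          case True
          then have zM: "height \<gamma> = real_of_int M" using res less.prems False by auto
          define u where "u = \<gamma> - real_of_int M *\<^sub>R v k"
          have u: "u \<in> sublattice v k" unfolding u_def by (rule layer_decomposition[OF less.prems(1) zM])
          have \<gamma>u: "\<gamma> = u + real_of_int M *\<^sub>R v k" by (simp add: u_def)
          have eqn: "of_real (lam - (norm (\<gamma>' + t))\<^sup>2) * hat \<phi> \<gamma>' = conv \<phi> \<gamma>'"
            if "\<gamma>' \<in> dual_lattice \<Omega>" "real_of_int N < height \<gamma>'" "height \<gamma>' < real_of_int M" for \<gamma>'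
          proof -
            have "hat g \<gamma>' = 0" using IH[of \<gamma>'] that zM less.prems False by simp
            then have "(of_real ((norm (\<gamma>' + t))\<^sup>2) - of_real lam) * hat \<phi> \<gamma>' + conv \<phi> \<gamma>' = 0"
              using hg[OF that(1)] by simp
            then show ?thesis by (simp add: left_diff_distrib algebra_simps)
          qed
          have "conv \<phi> \<gamma> = fourier_coeff F q (u - \<delta> + real_of_int (M - N) *\<^sub>R v k) +
              (\<Sum>h\<in>{1..M - N - 1}. \<Sum>\<^sub>\<infinity>u'\<in>sublattice v k.
                 c (u - u') (M - h) * fourier_coeff F q (u' + real_of_int h *\<^sub>R v k))"
            unfolding \<gamma>u by (rule conv_eq_recursion[OF \<phi> \<delta> low nonres eqn c u NM])
          also have "\<dots> = 0" using obstruction u True \<gamma>u by blast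
          finally have "conv \<phi> \<gamma> = 0" .
          then show ?thesis using hg[OF less.prems(1)] True by simp
        next
          case nr: False
          have "(of_real ((norm (\<gamma> + t))\<^sup>2) - of_real lam) ^ s' * hat g \<gamma> = 0"
            by (rule lowest_layer_resonant[OF g(2) less.prems(1)]) (use IH False less.prems in auto)
          moreover have "(of_real ((norm (\<gamma> + t))\<^sup>2) - of_real lam :: complex) \<noteq> 0"
            using nr by (simp only: of_real_diff[symmetric] of_real_eq_0_iff right_minus_eq) simp
          ultimately show ?thesis by simp
        qed
      qed
    qed
    obtain G where G: "(\<phi>, G) \<in> schroedinger_op F \<Omega> t q" "g = (\<lambda>x. G x - of_real lam * \<phi> x)"
      using g(1) by (auto simp: shifted_op_def)
    have "hat G \<gamma> = of_real lam * hat \<phi> \<gamma>" if \<gamma>: "\<gamma> \<in> dual_lattice \<Omega>" for \<gamma>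
    proof -
      have "hat g \<gamma> = 0" using below[OF \<gamma>] height_int[OF \<gamma>] by blast
      then show ?thesis using operator_hat[OF G(1) \<gamma>] hg[OF \<gamma>] by (simp add: left_diff_distrib algebra_simps)
    qed
    then have "(\<phi>, \<lambda>x. of_real lam * \<phi> x) \<in> schroedinger_op F \<Omega> t q"
      by (rule eigenfunction_if_coefficients[OF G(1)])
    then show ?eigen using nonzero by (auto simp: eigenfunction_def)
  qed
qed

text \<open>Finite partial sums are orthogonal to \<open>e\<^sub>\<gamma>\<close>, and orthogonality passes to the limit.\<close>

lemma hat_layer_sum:
  assumes "l2_has_sum F (\<lambda>u x. d u * expi (u + real_of_int r *\<^sub>R v k + t) x) f (sublattice v k)"
    and \<gamma>: "\<gamma> \<in> dual_lattice \<Omega>" "height \<gamma> \<noteq> real_of_int r"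
  shows "hat f \<gamma> = 0"
proof -
  have "((\<lambda>X. l2_inner F (\<lambda>x. \<Sum>u\<in>X. d u * expi (u + real_of_int r *\<^sub>R v k + t) x) (expi (\<gamma> + t)))
      \<longlongrightarrow> l2_inner F f (expi (\<gamma> + t))) (finite_subsets_at_top (sublattice v k))"
    using assms(1) unfolding l2_has_sum_def by (intro l2_inner_tendsto expi_l2)
  moreover have "\<forall>\<^sub>F X in finite_subsets_at_top (sublattice v k).
      l2_inner F (\<lambda>x. \<Sum>u\<in>X. d u * expi (u + real_of_int r *\<^sub>R v k + t) x) (expi (\<gamma> + t)) = 0"
  proof (rule eventually_finite_subsets_at_top_weakI)
    fix X assume X: "finite X" "X \<subseteq> sublattice v k"
    have "l2_inner F (\<lambda>x. \<Sum>u\<in>X. d u * expi (u + real_of_int r *\<^sub>R v k + t) x) (expi (\<gamma> + t))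
        = (\<Sum>u\<in>X. d u * l2_inner F (expi (u + real_of_int r *\<^sub>R v k + t)) (expi (\<gamma> + t)))"
      by (subst l2_sum(2)) (auto intro: l2_space_scale expi_l2 simp: l2_inner_scale)
    also have "\<dots> = 0"
    proof (intro sum.neutral ballI)
      fix u assume "u \<in> X"
      then have u: "u \<in> sublattice v k" using X by auto
      then have "height (u + real_of_int r *\<^sub>R v k) = real_of_int r"
        by (simp add: sublattice_iff height_linear height_basis)
      then have "u + real_of_int r *\<^sub>R v k \<noteq> \<gamma>" using \<gamma> by auto
      moreover have "u + real_of_int r *\<^sub>R v k - \<gamma> \<in> dual_lattice \<Omega>"
        using u \<gamma> by (auto simp: sublattice_iff intro: dual_lattice_add dual_lattice_diff v_mem)
      ultimately show "d u * l2_inner F (expi (u + real_of_int r *\<^sub>R v k + t)) (expi (\<gamma> + t)) = 0"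
        by (simp add: expi_orthonormal)
    qed
    finally show "l2_inner F (\<lambda>x. \<Sum>u\<in>X. d u * expi (u + real_of_int r *\<^sub>R v k + t) x) (expi (\<gamma> + t)) = 0" .
  qed
  ultimately have "((\<lambda>X. 0) \<longlongrightarrow> l2_inner F f (expi (\<gamma> + t))) (finite_subsets_at_top (sublattice v k))"
    by (rule Lim_transform_eventually)
  then show ?thesis unfolding hat_def
    using tendsto_unique[OF finite_subsets_at_top_neq_bot _ tendsto_const] by blast
qed

lemma hat_low_layers:
  assumes \<delta>: "\<delta> \<in> sublattice v k"
    and layer: "\<forall>r>N. l2_has_sum F
              (\<lambda>u x. l2_inner F \<phi> (expi (u + real_of_int r *\<^sub>R v k + t)) *
                     expi (u + real_of_int r *\<^sub>R v k + t) x) (layer r) (sublattice v k)"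
    and form: "l2_tendsto F
              (\<lambda>m x. expi (\<delta> + real_of_int N *\<^sub>R v k + t) x + (\<Sum>r\<in>{N + 1..N + int m}. layer r x))
              \<phi> sequentially"
    and \<gamma>: "\<gamma> \<in> dual_lattice \<Omega>" "height \<gamma> \<le> real_of_int N"
  shows "hat \<phi> \<gamma> = (if \<gamma> = \<delta> + real_of_int N *\<^sub>R v k then 1 else 0)"
proof -
  have l2: "layer r \<in> l2_space F" if "r > N" for r
    using layer that by (auto simp: l2_has_sum_def l2_tendsto_def)
  have zero: "hat (layer r) \<gamma> = 0" if "r > N" for r
    using layer that \<gamma> by (intro hat_layer_sum) auto
  have "l2_inner F (\<lambda>x. expi (\<delta> + real_of_int N *\<^sub>R v k + t) x + (\<Sum>r\<in>{N + 1..N + int m}. layer r x)) (expi (\<gamma> + t))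
      = (if \<gamma> = \<delta> + real_of_int N *\<^sub>R v k then 1 else 0)" for m
  proof -
    have s: "(\<lambda>x. \<Sum>r\<in>{N + 1..N + int m}. layer r x) \<in> l2_space F"
      "l2_inner F (\<lambda>x. \<Sum>r\<in>{N + 1..N + int m}. layer r x) (expi (\<gamma> + t))
        = (\<Sum>r\<in>{N + 1..N + int m}. hat (layer r) \<gamma>)"
      using l2_sum[of "{N + 1..N + int m}" layer F "expi (\<gamma> + t)"] l2 expi_l2
      by (simp_all add: hat_def)
    have "(\<Sum>r\<in>{N + 1..N + int m}. hat (layer r) \<gamma>) = 0" by (intro sum.neutral) (simp add: zero)
    moreover have "\<delta> + real_of_int N *\<^sub>R v k - \<gamma> \<in> dual_lattice \<Omega>"
      using \<delta> \<gamma> by (auto simp: sublattice_iff intro: dual_lattice_add dual_lattice_diff v_mem)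
    then have "l2_inner F (expi (\<delta> + real_of_int N *\<^sub>R v k + t)) (expi (\<gamma> + t))
        = (if \<gamma> = \<delta> + real_of_int N *\<^sub>R v k then 1 else 0)"
      by (subst expi_orthonormal) auto
    ultimately show ?thesis using l2_inner_add[OF expi_l2 s(1) expi_l2] s(2) by simp
  qed
  with l2_inner_tendsto[OF form expi_l2, of "\<gamma> + t"]
  have "(\<lambda>m::nat. if \<gamma> = \<delta> + real_of_int N *\<^sub>R v k then 1 else 0) \<longlonglongrightarrow> hat \<phi> \<gamma>"
    by (simp add: hat_def)
  then show ?thesis using LIMSEQ_unique tendsto_const by blast
qed

end

theorem theorem8:
  fixes \<Omega> F :: "(real^'n::finite) set"
    and w v :: "'n \<Rightarrow> real^'n" and k :: 'n and t :: "real^'n"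
    and lam :: real and m :: nat and b :: "nat \<Rightarrow> real^'n" and pidx :: "nat \<Rightarrow> int"
    and p :: nat and n :: "nat \<Rightarrow> int" and s :: "nat \<Rightarrow> nat" and a :: "nat \<Rightarrow> nat \<Rightarrow> real^'n"
    and q \<phi> :: "real^'n \<Rightarrow> complex" and j :: nat and \<delta> :: "real^'n"
    and layer :: "int \<Rightarrow> real^'n \<Rightarrow> complex" and c :: "real^'n \<Rightarrow> int \<Rightarrow> complex"
  assumes dim: "CARD('n) \<ge> 2"
    and Omega: "lattice_basis w \<Omega>"
    and F: "F = fundamental_domain w" "measure lebesgue F = 1"
    and Gamma: "lattice_basis v (dual_lattice \<Omega>)"
    and eigenvalue: "m \<ge> 2"
      "eigenvalue_of_multiplicity F (schroedinger_op F \<Omega> t (\<lambda>x. 0)) (complex_of_real lam) m"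
    and b: "bij_betw b {1..m} {\<gamma> \<in> dual_lattice \<Omega>. (norm (\<gamma> + t))\<^sup>2 = lam}"
    and pidx: "\<forall>i\<in>{1..m}. b i \<in> sublattice_layer v k (pidx i)"
    and n: "\<forall>l\<in>{1..p}. \<forall>l'\<in>{1..p}. l < l' \<longrightarrow> n l > n l'" "n ` {1..p} = pidx ` {1..m}"
    and a: "\<forall>l\<in>{1..p}. bij_betw (a l) {1..s l}
              {u \<in> sublattice v k. u + real_of_int (n l) *\<^sub>R v k \<in> b ` {1..m}}"
    and q: "q \<in> potentials_plus F v k"
    and p: "p \<ge> 2"
    and j: "j \<in> {1..s 2}"
    and delta: "\<delta> = a 2 j"
    and root: "root_function F (schroedinger_op F \<Omega> t q) (complex_of_real lam) \<phi>"
    and layer: "\<forall>r>n 2. l2_has_sum F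
              (\<lambda>u x. l2_inner F \<phi> (expi (u + real_of_int r *\<^sub>R v k + t)) *
                     expi (u + real_of_int r *\<^sub>R v k + t) x)
              (layer r) (sublattice v k)"
    and form: "l2_tendsto F
              (\<lambda>N x. expi (\<delta> + real_of_int (n 2) *\<^sub>R v k + t) x +
                     (\<Sum>r\<in>{n 2 + 1..n 2 + int N}. layer r x))
              \<phi> sequentially"
    and c: "\<forall>u\<in>sublattice v k. \<forall>r\<in>{n 2 + 1..n 1 - 1}.
              complex_of_real (lam - (norm (u + real_of_int r *\<^sub>R v k + t))\<^sup>2) * c u r =
              fourier_coeff F q (u - \<delta> + real_of_int (r - n 2) *\<^sub>R v k) +
              (\<Sum>h\<in>{1..r - n 2 - 1}. \<Sum>\<^sub>\<infinity>u'\<in>sublattice v k.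
                 c (u - u') (r - h) * fourier_coeff F q (u' + real_of_int h *\<^sub>R v k))"
  shows "(\<exists>\<mu>. eigenfunction F (schroedinger_op F \<Omega> t q) \<mu> \<phi>) \<longleftrightarrow>
         (\<forall>i\<in>{1..s 1}.
            fourier_coeff F q (a 1 i - \<delta> + real_of_int (n 1 - n 2) *\<^sub>R v k) +
            (\<Sum>h\<in>{1..n 1 - n 2 - 1}. \<Sum>\<^sub>\<infinity>u\<in>sublattice v k.
               c (a 1 i - u) (n 1 - h) * fourier_coeff F q (u + real_of_int h *\<^sub>R v k)) = 0)"
proof -
  interpret layered_lattice w \<Omega> F v k t q
    using Omega F Gamma q by unfold_locales
  have pI: "1 \<in> {1..p}" "2 \<in> {1..p}" using p by auto
  have bset: "b ` {1..m} = {\<gamma> \<in> dual_lattice \<Omega>. (norm (\<gamma> + t))\<^sup>2 = lam}"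
    using b by (auto simp: bij_betw_def)
  have aset: "a l ` {1..s l} = {u \<in> sublattice v k. (norm (u + real_of_int (n l) *\<^sub>R v k + t))\<^sup>2 = lam}"
    if "l \<in> {1..p}" for l
  proof -
    have "a l ` {1..s l} = {u \<in> sublattice v k. u + real_of_int (n l) *\<^sub>R v k \<in> b ` {1..m}}"
      using a that by (simp add: bij_betw_def)
    also have "\<dots> = {u \<in> sublattice v k. (norm (u + real_of_int (n l) *\<^sub>R v k + t))\<^sup>2 = lam}"
      unfolding bset by (auto simp: sublattice_iff intro: dual_lattice_add v_mem)
    finally show ?thesis .
  qed
  have "\<delta> \<in> a 2 ` {1..s 2}" using j delta by blast
  then have \<delta>: "\<delta> \<in> sublattice v k" "(norm (\<delta> + real_of_int (n 2) *\<^sub>R v k + t))\<^sup>2 = lam"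
    unfolding aset[OF pI(2)] by auto
  have n12: "n 2 < n 1" using n(1) pI by force
  have res: "height \<gamma> = real_of_int (n 1)"
    if \<gamma>: "\<gamma> \<in> dual_lattice \<Omega>" "(norm (\<gamma> + t))\<^sup>2 = lam" "real_of_int (n 2) < height \<gamma>" for \<gamma>
  proof -
    have "\<gamma> \<in> b ` {1..m}" using \<gamma> bset by auto
    then obtain i where i: "i \<in> {1..m}" "\<gamma> = b i" by auto
    then have h: "height \<gamma> = real_of_int (pidx i)" using pidx sublattice_layer_iff by blast
    have "pidx i \<in> n ` {1..p}" using n(2) i by auto
    then obtain l where l: "l \<in> {1..p}" "pidx i = n l" by auto
    have "l = 1"
    proof (rule ccontr)
      assume "l \<noteq> 1"
      then have "l = 2 \<or> 2 < l" using l by auto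
      then have "n l \<le> n 2" using n(1) l(1) pI(2) by force
      then show False using \<gamma>(3) h l by simp
    qed
    then show ?thesis using h l by simp
  qed
  have "(\<exists>\<mu>. eigenfunction F (schroedinger_op F \<Omega> t q) \<mu> \<phi>) \<longleftrightarrow>
    (\<forall>u\<in>sublattice v k. (norm (u + real_of_int (n 1) *\<^sub>R v k + t))\<^sup>2 = lam \<longrightarrow>
      fourier_coeff F q (u - \<delta> + real_of_int (n 1 - n 2) *\<^sub>R v k) +
      (\<Sum>h\<in>{1..n 1 - n 2 - 1}. \<Sum>\<^sub>\<infinity>u'\<in>sublattice v k.
         c (u - u') (n 1 - h) * fourier_coeff F q (u' + real_of_int h *\<^sub>R v k)) = 0)"
    by (rule eigenfunction_iff_obstruction_vanishes[OF root \<delta> hat_low_layers[OF \<delta>(1) layer form] n12 res c])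
  also have "\<dots> \<longleftrightarrow> (\<forall>u\<in>a 1 ` {1..s 1}.
      fourier_coeff F q (u - \<delta> + real_of_int (n 1 - n 2) *\<^sub>R v k) +
      (\<Sum>h\<in>{1..n 1 - n 2 - 1}. \<Sum>\<^sub>\<infinity>u'\<in>sublattice v k.
         c (u - u') (n 1 - h) * fourier_coeff F q (u' + real_of_int h *\<^sub>R v k)) = 0)"
    unfolding aset[OF pI(1)] by blast
  finally show ?thesis unfolding ball_simps(9) .
qed

end
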